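(* Let $m\ge 3$ and let $(X,<,a)$ be any Springer correspondence for the dihedral group $W=I_2(m)$ of order $2m$. Then every special piece of $I_2(m)$ is rationally smooth, and the full unipotent variety is also rationally smooth. Explicitly, if $P$ is the matrix of the associated system of Green functions: (a) For every special class $\mathcal C\in X$ with Springer representation $\chi$, and every $\chi'\in\mathrm{Irr}(W)$ whose support lies in the special piece of $\mathcal C$, one has $P_{\chi,\chi'}=q^{a_{\mathcal C}}$ if $\chi'$ is the Springer representation of its class, and $P_{\chi,\chi'}=0$ otherwise. (b) For every $\chi'\in\mathrm{Irr}(W)$, one has $P_{\chi_0,\chi'}=1$ if $\chi'$ is the Springer representation of its class, and $P_{\chi_0,\chi'}=0$ otherwise.
   Context: **Characters.** $W=I_2(m)$ acts on $V=\mathbb C^2$ by its (complexified) reflection representation. Its irreducible characters are: the trivial character $\chi_0$; the sign character $\epsilon=\det_V$; for $1\le i\le\lfloor (m-1)/2\rfloor$ the $2$-dimensional character $\chi_i$ in which the rotation by $2\pi/m$ has eigenvalues $e^{\pm 2\pi \sqrt{-1}\, i/m}$; and, if $m=2r$ is even, the two remaining $1$-dimensional characters $\chi_r,\chi_r'$ (those taking opposite signs on the two classes of reflections). **Fake degrees.** Let $q$ be an indeterminate. For a class function $f$ on $W$ set $$R(f)(q)=\frac{(q^2-1)(q^m-1)}{2m}\sum_{w\in W}\frac{\det_V(w)f(w)}{\det_V(q\cdot \mathrm{id}_V-w)}.$$ For $\chi\in\mathrm{Irr}(W)$, $R(\chi)$ is a polynomial (the fake degree), and $b_\chi$ is the exponent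 of the largest power of $q$ dividing it. One has $b_{\chi_i}=i$, $b_{\chi_r'}=r$, $b_\epsilon=m$. Let $\Omega=(\omega_{\chi,\chi'})_{\chi,\chi'\in\mathrm{Irr}(W)}$ with $\omega_{\chi,\chi'}=q^{m}R(\chi\otimes\chi'\otimes\epsilon)$. **Special characters and families** (with respect to the usual one-parameter Iwahori–Hecke algebra of $W$). The special characters are $\chi_0,\chi_1,\epsilon$. The families are $\{\chi_0\}$, $\{\epsilon\}$ and $\mathrm{Irr}(W)\setminus\{\chi_0,\epsilon\}$ (the last one containing $\chi_1$). **Lusztig–Shoji datum.** A triple $(X,<,a)$ where $X$ is a partition of $\mathrm{Irr}(W)$ into disjoint nonempty subsets $\mathcal C$, $<$ is a total order on $X$, and $a:X\to\mathbb N$, $\mathcal C\mapsto a_{\mathcal C}$, is a (weakly) order-reversing function. For $\chi\in\mathrm{Irr}(W)$, its support $\mathrm{supp}\,\chi$ denotes the member of $X$ containing $\chi$. **System of Green functions** with respect to $(X,<,a)$: a solution of the matrix equation $P\Lambda P^t=\Omega$, where $P,\Lambda$ are square matrices indexed by $\mathrm{Irr}(W)$ with entries in $\mathbb Q(q)$ such that $P_{\chi,\chi'}=0$ if $\mathrm{supp}\,\chi<\mathrm{supp}\,\chi'$; $P_{\chi,\chi'}=\delta_{\chi,\chi'}q^{a_{\mathcal C}}$ if $\mathrm{supp}\,\chi=\mathrm{supp}\,\chi'=\mathcal C$; and $\Lambda_{\chi,\chi'}=0$ if $\mathrm{supp}\,\chi\ne\mathrm{supp}\,\chi'$. It is a known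 fact that every Lusztig–Shoji datum admits a unique system of Green functions. **Springer correspondence.** A Lusztig–Shoji datum $(X,<,a)$ is a Springer correspondence if, with $P,\Lambda$ its system of Green functions: (1) for each $\mathcal C\in X$, $a_{\mathcal C}=\min\{b_\chi\mid\chi\in\mathcal C\}$, and there is a unique member of $\mathcal C$ (called the Springer representation of $\mathcal C$) on which $b$ attains its minimum value; (2) every special character is the Springer representation of some $\mathcal C\in X$; (3) if $\chi'$ is a nonspecial character in the same family as the special character $\chi$, then $\mathrm{supp}\,\chi'\le\mathrm{supp}\,\chi$; (4) the entries of $\Lambda$ are polynomials in $q$ with integer coefficients, and the entries of $P$ are polynomials in $q$ with nonnegative integer coefficients; (5) if $\chi\in\mathcal C$, then $P_{\chi,\chi'}$ is divisible by $q^{a_{\mathcal C}}$ for all $\chi'$. The sets $\mathcal C\in X$ are then called unipotent classes; a class is special if its Springer representation is a special character. **Closure order and special pieces.** The closure order $\preceq$ on $X$ is the transitive closure of the relation: $\mathcal C\preceq\mathcal C'$ if there exist characters $\psi'\in\mathcal C'$ and $\psi\in\mathcal C$ with $P_{\psi',\psi}\neq0$. A class $\mathcal C$ is said to be in the closure of $\mathcal C'$ if $\mathcal C\preceq\mathcal C'$. The special piece of a special class $\mathcal C$ is the union of $\mathcal C$ and all those nonspecial classes in its closure that are not in the closure of any smaller special class (i.e. of any special class $\mathcal D\preceq\mathcal C$, $\mathcal D\ne\mathcal C$). **Rational smoothness.** No actual variety is attached to $W$ in general. For algebraic groups, if $\chi$ (resp. $\chi'$) corresponds to the local system $\mathcal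 E$ on the unipotent class $C$ (resp. $\mathcal E'$ on $C'$), then $P_{\chi,\chi'}=\sum_{i\ge0}[\mathcal E':\mathcal H^i\mathrm{IC}(\bar C,\mathcal E)]\,q^{a(C)+i}$, and Springer representations correspond to trivial local systems; a variety $Z$ is rationally smooth if $\mathcal H^i_z\mathrm{IC}(Z,\bar{\mathbb Q}_\ell)$ is $\bar{\mathbb Q}_\ell$ for $i=0$ and $0$ for $i\neq0$, for all $z\in Z$. Rational smoothness of a special piece, or of the full unipotent variety (the closure of the class of $\chi_0$, consisting of all classes), of $I_2(m)$ is understood via this formula, i.e. as the conditions on entries of $P$ in (a), respectively (b). *)

theory Defs
  imports
    "HOL-Library.FuncSet"
    "HOL-Library.Disjoint_Sets"
    "HOL-Computational_Algebra.Polynomial_Factorial"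
    "Jordan_Normal_Form.Char_Poly"
    "Jordan_Normal_Form.VS_Connect"
begin

section \<open>The dihedral group and its irreducible characters\<close>

text \<open>The group is realised inside \<open>GL(V)\<close>, where \<open>V\<close> is the complexified reflection
  representation, so that \<open>det\<close> and \<open>char_poly\<close> of a group element are \<open>det_V w\<close> and
  \<open>det_V (q id - w)\<close>.\<close>

definition rotation :: "real \<Rightarrow> complex mat" where
  "rotation t = mat_of_rows_list 2
     [[of_real (cos t), of_real (- sin t)],
      [of_real (sin t), of_real (cos t)]]"

definition reflection :: "real \<Rightarrow> complex mat" where
  "reflection t = mat_of_rows_list 2
     [[of_real (cos t), of_real (sin t)],
      [of_real (sin t), of_real (- cos t)]]"

definition dihedral :: "nat \<Rightarrow> complex mat set" where
  "dihedral m = (\<lambda>k. rotation (2 * pi * real k / real m)) ` {..<m}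
              \<union> (\<lambda>k. reflection (2 * pi * real k / real m)) ` {..<m}"

definition representation ::
    "nat \<Rightarrow> nat \<Rightarrow> (complex mat \<Rightarrow> complex mat) \<Rightarrow> bool" where
  "representation m n \<rho> \<longleftrightarrow>
     (\<forall>w\<in>dihedral m. \<rho> w \<in> carrier_mat n n) \<and>
     \<rho> (1\<^sub>m 2) = 1\<^sub>m n \<and>
     (\<forall>v\<in>dihedral m. \<forall>w\<in>dihedral m. \<rho> (v * w) = \<rho> v * \<rho> w)"

definition irreducible_representation ::
    "nat \<Rightarrow> nat \<Rightarrow> (complex mat \<Rightarrow> complex mat) \<Rightarrow> bool" where
  "irreducible_representation m n \<rho> \<longleftrightarrow>
     representation m n \<rho> \<and> n > 0 \<and>
     (\<forall>U. VectorSpace.subspace class_ring U (module_vec TYPE(complex) n) \<and>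
          (\<forall>w\<in>dihedral m. \<forall>u\<in>U. \<rho> w *\<^sub>v u \<in> U)
        \<longrightarrow> U = {0\<^sub>v n} \<or> U = carrier_vec n)"

definition mat_trace :: "complex mat \<Rightarrow> complex" where
  "mat_trace A = (\<Sum>i<dim_row A. A $$ (i, i))"

type_synonym class_fun = "complex mat \<Rightarrow> complex"

text \<open>Characters are made \<open>undefined\<close> off the group, so that they are equal as HOL functions
  exactly when they agree on the group.\<close>

definition irr :: "nat \<Rightarrow> class_fun set" where
  "irr m = {\<chi>. \<exists>n \<rho>. irreducible_representation m n \<rho> \<and>
                    \<chi> = (\<lambda>w\<in>dihedral m. mat_trace (\<rho> w))}"

definition triv_char :: "nat \<Rightarrow> class_fun" where
  "triv_char m = (\<lambda>w\<in>dihedral m. 1)"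

definition sign_char :: "nat \<Rightarrow> class_fun" where
  "sign_char m = (\<lambda>w\<in>dihedral m. det w)"

text \<open>The character \<open>\<chi>\<^sub>1\<close>, in which the rotation by \<open>2\<pi>/m\<close> has eigenvalues
  \<open>exp (\<plusminus>2\<pi>\<i>/m)\<close>, is the character of \<open>V\<close> itself.\<close>

definition refl_char :: "nat \<Rightarrow> class_fun" where
  "refl_char m = (\<lambda>w\<in>dihedral m. mat_trace w)"


section \<open>Fake degrees\<close>

text \<open>The ambient field is \<open>\<complex>(q)\<close>, since values of characters need not be rational;
  membership in \<open>\<rat>(q)\<close> is the predicate \<open>rational_fun\<close>.\<close>

abbreviation q_var :: "complex poly fract" where
  "q_var \<equiv> to_fract [:0, 1:]"

definition rational_fun :: "complex poly fract \<Rightarrow> bool" where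
  "rational_fun f \<longleftrightarrow> (\<exists>(g :: rat poly) (h :: rat poly). h \<noteq> 0 \<and>
     f = to_fract (map_poly of_rat g) / to_fract (map_poly of_rat h))"

definition int_polynomial :: "complex poly fract \<Rightarrow> bool" where
  "int_polynomial f \<longleftrightarrow> (\<exists>g :: int poly. f = to_fract (map_poly of_int g))"

definition nat_polynomial :: "complex poly fract \<Rightarrow> bool" where
  "nat_polynomial f \<longleftrightarrow> (\<exists>g :: nat poly. f = to_fract (map_poly of_nat g))"

definition q_power_dvd :: "nat \<Rightarrow> complex poly fract \<Rightarrow> bool" where
  "q_power_dvd k f \<longleftrightarrow> (\<exists>g :: complex poly. f = q_var ^ k * to_fract g)"

definition fake_degree :: "nat \<Rightarrow> class_fun \<Rightarrow> complex poly fract" where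
  "fake_degree m f =
     (q_var ^ 2 - 1) * (q_var ^ m - 1) / of_nat (2 * m) *
     (\<Sum>w\<in>dihedral m. to_fract [: det w * f w :] / to_fract (char_poly w))"

definition b_inv :: "nat \<Rightarrow> class_fun \<Rightarrow> nat" where
  "b_inv m \<chi> = (GREATEST k. q_power_dvd k (fake_degree m \<chi>))"

definition omega :: "nat \<Rightarrow> class_fun \<Rightarrow> class_fun \<Rightarrow> complex poly fract" where
  "omega m \<chi> \<chi>' = q_var ^ m * fake_degree m (\<lambda>w. \<chi> w * \<chi>' w * sign_char m w)"


section \<open>Special characters and families\<close>

definition special_chars :: "nat \<Rightarrow> class_fun set" where
  "special_chars m = {triv_char m, refl_char m, sign_char m}"

definition families :: "nat \<Rightarrow> class_fun set set" where
  "families m = {{triv_char m}, {sign_char m}, irr m - {triv_char m, sign_char m}}"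


section \<open>Lusztig--Shoji data and Green functions\<close>

text \<open>The strict total order on \<open>X\<close> is the set \<open>lt\<close> of pairs \<open>(C, D)\<close> with \<open>C < D\<close>.\<close>

definition lusztig_shoji_datum ::
    "nat \<Rightarrow> class_fun set set \<Rightarrow> class_fun set rel \<Rightarrow> (class_fun set \<Rightarrow> nat) \<Rightarrow> bool" where
  "lusztig_shoji_datum m X lt a \<longleftrightarrow>
     partition_on (irr m) X \<and>
     lt \<subseteq> X \<times> X \<and> strict_linear_order_on X lt \<and>
     (\<forall>(C, D)\<in>lt. a D \<le> a C)"

definition supp :: "class_fun set set \<Rightarrow> class_fun \<Rightarrow> class_fun set" where
  "supp X \<chi> = (THE C. C \<in> X \<and> \<chi> \<in> C)"

type_synonym char_matrix = "class_fun \<Rightarrow> class_fun \<Rightarrow> complex poly fract"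

text \<open>Matrices indexed by \<open>irr m\<close> are functions of two arguments; only their values on
  \<open>irr m\<close> matter.\<close>

definition green_system ::
    "nat \<Rightarrow> class_fun set set \<Rightarrow> class_fun set rel \<Rightarrow> (class_fun set \<Rightarrow> nat) \<Rightarrow>
     char_matrix \<Rightarrow> char_matrix \<Rightarrow> bool" where
  "green_system m X lt a P \<Lambda> \<longleftrightarrow>
     (\<forall>\<chi>\<in>irr m. \<forall>\<chi>'\<in>irr m. rational_fun (P \<chi> \<chi>') \<and> rational_fun (\<Lambda> \<chi> \<chi>')) \<and>
     (\<forall>\<chi>\<in>irr m. \<forall>\<chi>'\<in>irr m.
        (\<Sum>\<phi>\<in>irr m. \<Sum>\<psi>\<in>irr m. P \<chi> \<phi> * \<Lambda> \<phi> \<psi> * P \<chi>' \<psi>) = omega m \<chi> \<chi>') \<and>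
     (\<forall>\<chi>\<in>irr m. \<forall>\<chi>'\<in>irr m. (supp X \<chi>, supp X \<chi>') \<in> lt \<longrightarrow> P \<chi> \<chi>' = 0) \<and>
     (\<forall>C\<in>X. \<forall>\<chi>\<in>C. \<forall>\<chi>'\<in>C. P \<chi> \<chi>' = (if \<chi> = \<chi>' then q_var ^ a C else 0)) \<and>
     (\<forall>\<chi>\<in>irr m. \<forall>\<chi>'\<in>irr m. supp X \<chi> \<noteq> supp X \<chi>' \<longrightarrow> \<Lambda> \<chi> \<chi>' = 0)"


section \<open>Springer correspondences\<close>

definition springer_rep :: "nat \<Rightarrow> class_fun set \<Rightarrow> class_fun \<Rightarrow> bool" where
  "springer_rep m C \<chi> \<longleftrightarrow> \<chi> \<in> C \<and> b_inv m \<chi> = Min (b_inv m ` C)"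

text \<open>The system of Green functions of a datum is unique; it is an argument here.\<close>

definition springer_correspondence ::
    "nat \<Rightarrow> class_fun set set \<Rightarrow> class_fun set rel \<Rightarrow> (class_fun set \<Rightarrow> nat) \<Rightarrow>
     char_matrix \<Rightarrow> char_matrix \<Rightarrow> bool" where
  "springer_correspondence m X lt a P \<Lambda> \<longleftrightarrow>
     lusztig_shoji_datum m X lt a \<and> green_system m X lt a P \<Lambda> \<and>
     (\<forall>C\<in>X. a C = Min (b_inv m ` C) \<and> (\<exists>!\<chi>. springer_rep m C \<chi>)) \<and>
     (\<forall>\<chi>\<in>special_chars m. \<exists>C\<in>X. springer_rep m C \<chi>) \<and>
     (\<forall>F\<in>families m. \<forall>\<chi>\<in>F \<inter> special_chars m. \<forall>\<chi>'\<in>F - special_chars m.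
        supp X \<chi>' = supp X \<chi> \<or> (supp X \<chi>', supp X \<chi>) \<in> lt) \<and>
     (\<forall>\<chi>\<in>irr m. \<forall>\<chi>'\<in>irr m. int_polynomial (\<Lambda> \<chi> \<chi>') \<and> nat_polynomial (P \<chi> \<chi>')) \<and>
     (\<forall>C\<in>X. \<forall>\<chi>\<in>C. \<forall>\<chi>'\<in>irr m. q_power_dvd (a C) (P \<chi> \<chi>'))"

definition special_class :: "nat \<Rightarrow> class_fun set set \<Rightarrow> class_fun set \<Rightarrow> bool" where
  "special_class m X C \<longleftrightarrow> C \<in> X \<and> (\<exists>\<chi>\<in>special_chars m. springer_rep m C \<chi>)"

text \<open>A pair \<open>(C, C')\<close> in \<open>closure_rel X P\<close> means that \<open>C\<close> lies in the closure of \<open>C'\<close>.\<close>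

definition closure_rel :: "class_fun set set \<Rightarrow> char_matrix \<Rightarrow> class_fun set rel" where
  "closure_rel X P =
     {(C, C'). C \<in> X \<and> C' \<in> X \<and> (\<exists>\<psi>'\<in>C'. \<exists>\<psi>\<in>C. P \<psi>' \<psi> \<noteq> 0)}\<^sup>+"

definition special_piece ::
    "nat \<Rightarrow> class_fun set set \<Rightarrow> char_matrix \<Rightarrow> class_fun set \<Rightarrow> class_fun set" where
  "special_piece m X P C =
     C \<union> \<Union>{D \<in> X. \<not> special_class m X D \<and> (D, C) \<in> closure_rel X P \<and>
              \<not> (\<exists>E. special_class m X E \<and> (E, C) \<in> closure_rel X P \<and> E \<noteq> C \<and>
                     (D, E) \<in> closure_rel X P)}"

end

theory Submission
  imports Defs "Jordan_Normal_Form.Spectral_Radius"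
begin

text \<open>If \<open>s\<close> is the Springer representation of \<open>\<C>\<close> and \<open>b = b\<^sub>s\<close>, then \<open>a\<close> being order reversing
  forces \<open>b\<^sub>\<chi> \<ge> b\<close> for all \<open>\<chi>\<close> in classes below \<open>\<C>\<close>, and for such \<open>\<chi>\<close> the row of \<open>s\<close> in \<open>\<Omega>\<close> is
  \<open>q\<^sup>b\<close> times the row of \<open>\<chi>\<^sub>0\<close> plus a multiple of the row of \<open>\<epsilon>\<close>. Because \<open>\<Omega>\<close>, hence every block of
  \<open>\<Lambda>\<close>, is nondegenerate, relations between rows of \<open>\<Omega>\<close> that hold on all columns below \<open>\<C>\<close> are inherited
  by the rows of \<open>P\<close>. The row of \<open>\<epsilon>\<close> in \<open>P\<close> vanishes off \<open>\<epsilon>\<close>, so \<open>P\<^bsub>s,\<chi>\<^esub> = q\<^sup>b P\<^bsub>\<chi>\<^sub>0,\<chi>\<^esub>\<close>; on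
  \<open>\<C>\<close> itself the left side is \<open>\<delta>\<^bsub>s,\<chi>\<^esub> q\<^sup>b\<close>, which gives (b). For \<open>s = \<chi>\<^sub>1\<close> the relation holds on all
  classes below that of \<open>\<chi>\<^sub>1\<close>, which turns (b) into (a).\<close>

section \<open>The dihedral group\<close>

text \<open>The relation in \<Omega> comes from the tensor product of the two-dimensional characters
  of indices n <= l, which contributes q^(l+n), q^(m-l-n), q^(l-n), q^(m-l+n). These group into q^n
  (q^l + q^(m-l)) and q^-n (q^l + q^(m-l)), while q^l + q^(m-l) is, up to the common factor q^m, the
  entry at index l of the rows of both \<chi>_0 and \<epsilon>. For l < n the exponent l - n changes
  sign and the grouping is lost; hence the bound on b. The obstacle is the pair \<chi>_r, \<chi>_r'
  for m = 2r: both have b = r, so the bound cannot separate them, and at \<chi>_r' the row of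
  \<chi>_r is a multiple of the row of \<epsilon> alone. Inheritance by P is back substitution: P is
  block triangular with powers of q on the diagonal. If w \<Lambda> P^t vanishes on a suitably
  closed set of columns, so does w \<Lambda>, and the invertible blocks of \<Lambda> give w = 0
  there.\<close>

lemma rotation_carrier [simp]: "rotation t \<in> carrier_mat 2 2"
  by (simp add: rotation_def mat_of_rows_list_def numeral_2_eq_2)

lemma reflection_carrier [simp]: "reflection t \<in> carrier_mat 2 2"
  by (simp add: reflection_def mat_of_rows_list_def numeral_2_eq_2)

lemma rotation_index [simp]:
  "rotation t $$ (0, 0) = of_real (cos t)" "rotation t $$ (0, Suc 0) = - of_real (sin t)"
  "rotation t $$ (Suc 0, 0) = of_real (sin t)" "rotation t $$ (Suc 0, Suc 0) = of_real (cos t)"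
  by (simp_all add: rotation_def mat_of_rows_list_def)

lemma reflection_index [simp]:
  "reflection t $$ (0, 0) = of_real (cos t)" "reflection t $$ (0, Suc 0) = of_real (sin t)"
  "reflection t $$ (Suc 0, 0) = of_real (sin t)" "reflection t $$ (Suc 0, Suc 0) = - of_real (cos t)"
  by (simp_all add: reflection_def mat_of_rows_list_def)

lemma mat2_eqI:
  assumes "A \<in> carrier_mat 2 2" "B \<in> carrier_mat 2 2"
    and "A $$ (0, 0) = B $$ (0, 0)" "A $$ (0, Suc 0) = B $$ (0, Suc 0)"
    and "A $$ (Suc 0, 0) = B $$ (Suc 0, 0)" "A $$ (Suc 0, Suc 0) = B $$ (Suc 0, Suc 0)"
  shows "A = B"
proof (rule eq_matI)
  fix i j assume "i < dim_row B" "j < dim_col B"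
  then have "i = 0 \<or> i = Suc 0" "j = 0 \<or> j = Suc 0" using assms(2) by auto
  then show "A $$ (i, j) = B $$ (i, j)" using assms by auto
qed (use assms in auto)

lemma mat2_mult_index:
  assumes "A \<in> carrier_mat 2 2" "B \<in> carrier_mat 2 2" "i < 2" "j < 2"
  shows "(A * B) $$ (i, j) = A $$ (i, 0) * B $$ (0, j) + A $$ (i, Suc 0) * B $$ (Suc 0, j)"
  using assms by (simp add: scalar_prod_def numeral_2_eq_2)

lemma rotation_mult: "rotation s * rotation t = rotation (s + t)"
  by (rule mat2_eqI, rule mult_carrier_mat[OF rotation_carrier rotation_carrier])
     (simp_all add: mat2_mult_index cos_add sin_add algebra_simps flip: of_real_mult of_real_add of_real_diff of_real_minus)

lemma rotation_mult_reflection: "rotation s * reflection t = reflection (s + t)"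
  by (rule mat2_eqI, rule mult_carrier_mat[OF rotation_carrier reflection_carrier])
     (simp_all add: mat2_mult_index cos_add sin_add algebra_simps flip: of_real_mult of_real_add of_real_diff of_real_minus)

lemma reflection_mult_rotation: "reflection s * rotation t = reflection (s - t)"
  by (rule mat2_eqI, rule mult_carrier_mat[OF reflection_carrier rotation_carrier])
     (simp_all add: mat2_mult_index cos_diff sin_diff algebra_simps flip: of_real_mult of_real_add of_real_diff of_real_minus)

lemma reflection_mult_reflection: "reflection s * reflection t = rotation (s - t)"
  by (rule mat2_eqI, rule mult_carrier_mat[OF reflection_carrier reflection_carrier])
     (simp_all add: mat2_mult_index cos_diff sin_diff algebra_simps flip: of_real_mult of_real_add of_real_diff of_real_minus)

lemma rotation_0: "rotation 0 = 1\<^sub>m 2"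
  by (rule mat2_eqI) simp_all

lemma rotation_periodic: "rotation (t + 2 * pi) = rotation t"
  by (rule mat2_eqI) (simp_all add: cos_add sin_add)

lemma reflection_periodic: "reflection (t + 2 * pi) = reflection t"
  by (rule mat2_eqI) (simp_all add: cos_add sin_add)

lemma det2:
  assumes "A \<in> carrier_mat 2 2"
  shows "det A = A $$ (0, 0) * A $$ (Suc 0, Suc 0) - A $$ (0, Suc 0) * A $$ (Suc 0, 0)"
proof -
  have "det A = (\<Sum>j<2. A $$ (0, j) * cofactor A 0 j)"
    by (rule laplace_expansion_row[OF assms]) simp
  then show ?thesis using assms
    by (simp add: cofactor_def numeral_2_eq_2 mat_delete_def det_single)
qed


section \<open>Rotations and reflections indexed by natural numbers\<close>

definition rot :: "nat \<Rightarrow> nat \<Rightarrow> complex mat" where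
  "rot m k = rotation (2 * pi * real k / real m)"

definition mirror :: "nat \<Rightarrow> nat \<Rightarrow> complex mat" where
  "mirror m k = reflection (2 * pi * real k / real m)"

lemma rot_carrier [simp]: "rot m k \<in> carrier_mat 2 2"
  and mirror_carrier [simp]: "mirror m k \<in> carrier_mat 2 2"
  by (simp_all add: rot_def mirror_def)

lemma dihedral_eq: "dihedral m = rot m ` {..<m} \<union> mirror m ` {..<m}"
  by (simp add: dihedral_def rot_def mirror_def)

lemma rot_in_dihedral: "k < m \<Longrightarrow> rot m k \<in> dihedral m"
  and mirror_in_dihedral: "k < m \<Longrightarrow> mirror m k \<in> dihedral m"
  by (auto simp: dihedral_eq)

lemma rot_0: "rot m 0 = 1\<^sub>m 2"
  by (simp add: rot_def rotation_0)

lemma rot_mult: "rot m j * rot m k = rot m (j + k)"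
  by (simp add: rot_def rotation_mult add_divide_distrib distrib_left)

lemma rot_mult_mirror: "rot m j * mirror m k = mirror m (j + k)"
  by (simp add: rot_def mirror_def rotation_mult_reflection add_divide_distrib distrib_left)

lemma rot_add_period: "0 < m \<Longrightarrow> rot m (k + m) = rot m k"
  using rotation_periodic[of "2 * pi * real k / real m"]
  by (simp add: rot_def add_divide_distrib distrib_left)

lemma mirror_mult_mirror: "k \<le> j \<Longrightarrow> mirror m j * mirror m k = rot m (j - k)"
  by (simp add: rot_def mirror_def reflection_mult_reflection of_nat_diff diff_divide_distrib right_diff_distrib)

text \<open>The dihedral relation s r^k = r^-k s, with r^-k written as r^(m-k) to keep indices
  natural. It is used at \<open>k = m - 1\<close>, from right to left, to move the generating
  rotation past a reflection.\<close>

lemma mirror_0_mult_rot: "k \<le> m \<Longrightarrow> 0 < m \<Longrightarrow> mirror m 0 * rot m k = rot m (m - k) * mirror m 0"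
  using reflection_periodic[of "- (2 * pi * real k / real m)"]
  by (simp add: rot_def mirror_def reflection_mult_rotation rotation_mult_reflection of_nat_diff
      diff_divide_distrib right_diff_distrib)

lemma det_rot [simp]: "det (rot m k) = 1"
  by (simp add: rot_def det2 flip: of_real_mult of_real_add of_real_diff of_real_minus)

lemma det_mirror [simp]: "det (mirror m k) = - 1"
proof -
  have "cos t * cos t = 1 - sin t * sin t" for t :: real
    by (simp add: cos_squared_eq flip: power2_eq_square)
  then show ?thesis
    by (simp add: mirror_def det2 flip: of_real_mult of_real_add of_real_diff) simp
qed

lemma char_poly2:
  assumes "A \<in> carrier_mat 2 2"
  shows "char_poly A = [:det A, - (A $$ (0, 0) + A $$ (Suc 0, Suc 0)), 1:]"
  using assms unfolding char_poly_def char_poly_matrix_def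
  by (subst det2, simp, subst det2[OF assms]) (simp add: algebra_simps)

lemma char_poly_rot: "char_poly (rot m k) = [:1, - of_real (2 * cos (2 * pi * real k / real m)), 1:]"
  by (simp add: char_poly2) (simp add: rot_def)

lemma char_poly_mirror: "char_poly (mirror m k) = [:- 1, 0, 1:]"
  by (simp add: char_poly2) (simp add: mirror_def)

lemma mat_trace2: "A \<in> carrier_mat 2 2 \<Longrightarrow> mat_trace A = A $$ (0, 0) + A $$ (Suc 0, Suc 0)"
  by (simp add: mat_trace_def numeral_2_eq_2)

lemma inj_on_cos_sin: 
  assumes "cos s = cos t" "sin s = sin t" "0 \<le> s" "s < 2 * pi" "0 \<le> t" "t < 2 * pi"
  shows "s = t"
proof -
  obtain n :: int where "s = t + 2 * pi * of_int n"
    using assms(1,2) sin_cos_eq_iff by metis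
  moreover have "n = 0"
  proof (rule ccontr)
    assume "n \<noteq> 0"
    then have "real_of_int n \<ge> 1 \<or> real_of_int n \<le> -1" by linarith
    then have "2 * pi * of_int n \<ge> 2 * pi \<or> 2 * pi * of_int n \<le> - (2 * pi)"
      by (metis mult.right_neutral mult_left_mono mult_minus_right pi_ge_zero mult_nonneg_nonneg zero_le_numeral)
    with calculation assms(3-6) show False by linarith
  qed
  ultimately show ?thesis by simp
qed

lemma angle_inj:
  assumes "cos (2 * pi * real j / real m) = cos (2 * pi * real k / real m)"
    and "sin (2 * pi * real j / real m) = sin (2 * pi * real k / real m)"
    and "j < m" "k < m"
  shows "j = k"
proof -
  have "2 * pi * real j / real m = 2 * pi * real k / real m"
    by (rule inj_on_cos_sin) (use assms in \<open>auto simp: field_simps\<close>)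
  then show ?thesis using assms by simp
qed

lemma inj_on_rot: "inj_on (rot m) {..<m}"
proof (rule inj_onI)
  fix j k assume "j \<in> {..<m}" "k \<in> {..<m}" and eq: "rot m j = rot m k"
  have "rot m j $$ (0,0) = rot m k $$ (0,0)" "rot m j $$ (Suc 0,0) = rot m k $$ (Suc 0,0)"
    by (simp_all add: eq)
  then show "j = k" using \<open>j \<in> _\<close> \<open>k \<in> _\<close> by (intro angle_inj) (simp_all add: rot_def)
qed

lemma inj_on_mirror: "inj_on (mirror m) {..<m}"
proof (rule inj_onI)
  fix j k assume "j \<in> {..<m}" "k \<in> {..<m}" and eq: "mirror m j = mirror m k"
  have "mirror m j $$ (0,0) = mirror m k $$ (0,0)" "mirror m j $$ (Suc 0,0) = mirror m k $$ (Suc 0,0)"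
    by (simp_all add: eq)
  then show "j = k" using \<open>j \<in> _\<close> \<open>k \<in> _\<close> by (intro angle_inj) (simp_all add: mirror_def)
qed

lemma sum_dihedral:
  "(\<Sum>w\<in>dihedral m. f w) = (\<Sum>k<m. f (rot m k)) + (\<Sum>k<m. f (mirror m k))"
proof -
  have "rot m j \<noteq> mirror m k" for j k
  proof
    assume "rot m j = mirror m k"
    then have "det (rot m j) = det (mirror m k)" by simp
    then show False by simp
  qed
  then have "rot m ` {..<m} \<inter> mirror m ` {..<m} = {}" by auto
  then show ?thesis
    by (simp add: dihedral_eq sum.union_disjoint sum.reindex inj_on_rot inj_on_mirror)
qed

section \<open>Irreducible characters\<close>

lemma mult_mat_vec_lincomb:
  fixes M :: "complex mat"
  assumes "M \<in> carrier_mat n n" "v \<in> carrier_vec n" "w \<in> carrier_vec n"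
  shows "M *\<^sub>v (\<alpha> \<cdot>\<^sub>v v + \<beta> \<cdot>\<^sub>v w) = \<alpha> \<cdot>\<^sub>v (M *\<^sub>v v) + \<beta> \<cdot>\<^sub>v (M *\<^sub>v w)"
  using assms by (simp add: mult_add_distrib_mat_vec mult_mat_vec)

text \<open>The span of \<open>v\<close> and \<open>w\<close> is a nonzero invariant subspace, hence
  everything. Taking \<open>w = v\<close> covers the case of a common eigenvector. The
  coordinatewise conclusion lets dimensions be bounded by testing unit vectors.\<close>

lemma irreducible_span2:
  assumes irr: "irreducible_representation m n \<rho>"
    and v: "v \<in> carrier_vec n" "v \<noteq> 0\<^sub>v n" and w: "w \<in> carrier_vec n"
    and inv: "\<And>g. g \<in> dihedral m \<Longrightarrow> \<exists>a b. \<rho> g *\<^sub>v v = a \<cdot>\<^sub>v v + b \<cdot>\<^sub>v w"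
             "\<And>g. g \<in> dihedral m \<Longrightarrow> \<exists>a b. \<rho> g *\<^sub>v w = a \<cdot>\<^sub>v v + b \<cdot>\<^sub>v w"
    and x: "x \<in> carrier_vec n"
  obtains a b where "\<And>i. i < n \<Longrightarrow> x $ i = a * v $ i + b * w $ i"
proof -
  define U where "U = {a \<cdot>\<^sub>v v + b \<cdot>\<^sub>v w | a b. True}"
  have add: "(a \<cdot>\<^sub>v v + b \<cdot>\<^sub>v w) + (c \<cdot>\<^sub>v v + d \<cdot>\<^sub>v w) = (a + c) \<cdot>\<^sub>v v + (b + d) \<cdot>\<^sub>v w" for a b c d
    using v w by (intro eq_vecI) (auto simp: algebra_simps)
  have smult: "c \<cdot>\<^sub>v (a \<cdot>\<^sub>v v + b \<cdot>\<^sub>v w) = (c * a) \<cdot>\<^sub>v v + (c * b) \<cdot>\<^sub>v w" for a b c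
    using v w by (intro eq_vecI) (auto simp: algebra_simps)
  have "0 \<cdot>\<^sub>v v + 0 \<cdot>\<^sub>v w = 0\<^sub>v n"
    using v w by (intro eq_vecI) auto
  then have zero: "0\<^sub>v n \<in> U" unfolding U_def by (metis (mono_tags, lifting) mem_Collect_eq)
  interpret V: vectorspace class_ring "module_vec TYPE(complex) n" by (rule vec_vs)
  have "VectorSpace.subspace class_ring U (module_vec TYPE(complex) n)"
    unfolding subspace_def submodule_def module_vec_simps
  proof (intro conjI allI impI)
    show "U \<subseteq> carrier_vec n" using v w by (auto simp: U_def)
    show "p + q \<in> U" if "p \<in> U" "q \<in> U" for p q
      using that add unfolding U_def by blast
    show "c \<cdot>\<^sub>v p \<in> U" if "p \<in> U" for c p
      using that smult unfolding U_def by blast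
  qed (use zero V.vectorspace_axioms V.module_axioms in auto)
  moreover have "\<rho> g *\<^sub>v u \<in> U" if g: "g \<in> dihedral m" and u: "u \<in> U" for g u
  proof -
    obtain a b where u: "u = a \<cdot>\<^sub>v v + b \<cdot>\<^sub>v w" using u by (auto simp: U_def)
    obtain a1 b1 a2 b2 where "\<rho> g *\<^sub>v v = a1 \<cdot>\<^sub>v v + b1 \<cdot>\<^sub>v w" "\<rho> g *\<^sub>v w = a2 \<cdot>\<^sub>v v + b2 \<cdot>\<^sub>v w"
      using inv g by blast
    moreover have "\<rho> g \<in> carrier_mat n n"
      using irr g by (simp add: irreducible_representation_def representation_def)
    ultimately have "\<rho> g *\<^sub>v u = (a * a1 + b * a2) \<cdot>\<^sub>v v + (a * b1 + b * b2) \<cdot>\<^sub>v w"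
      using v w by (simp add: u mult_mat_vec_lincomb smult add)
    then show ?thesis unfolding U_def by blast
  qed
  ultimately have "U = {0\<^sub>v n} \<or> U = carrier_vec n"
    using irr by (auto simp: irreducible_representation_def)
  moreover have "1 \<cdot>\<^sub>v v + 0 \<cdot>\<^sub>v w = v"
    using v w by (intro eq_vecI) auto
  then have "v \<in> U" unfolding U_def by (metis (mono_tags, lifting) mem_Collect_eq)
  ultimately have "x \<in> U" using v x by auto
  then obtain a b where "x = a \<cdot>\<^sub>v v + b \<cdot>\<^sub>v w" by (auto simp: U_def)
  then have "x $ i = a * v $ i + b * w $ i" if "i < n" for i
    using that v w by auto
  then show thesis by (rule that)
qed

text \<open>Cramer's rule: the trace times the determinant of the basis is a combination of the four
  coordinate equations for the images of \<open>v\<close> and \<open>w\<close>, and the determinant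
  cancels.\<close>

lemma trace_of_basis:
  fixes M :: "complex mat"
  assumes M: "M \<in> carrier_mat 2 2" and v: "v \<in> carrier_vec 2" and w: "w \<in> carrier_vec 2"
    and indep: "v $ 0 * w $ 1 \<noteq> v $ 1 * w $ 0"
    and Mv: "M *\<^sub>v v = a \<cdot>\<^sub>v v + b \<cdot>\<^sub>v w" and Mw: "M *\<^sub>v w = c \<cdot>\<^sub>v v + d \<cdot>\<^sub>v w"
  shows "mat_trace M = a + d"
proof -
  have idx: "(M *\<^sub>v x) $ i = M $$ (i, 0) * x $ 0 + M $$ (i, Suc 0) * x $ Suc 0"
    if "x \<in> carrier_vec 2" "i < 2" for x i
    using M that by (simp add: scalar_prod_def numeral_2_eq_2)
  have "M $$ (0,0) * v $ 0 + M $$ (0, Suc 0) * v $ Suc 0 = a * v $ 0 + b * w $ 0"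
    "M $$ (Suc 0,0) * v $ 0 + M $$ (Suc 0, Suc 0) * v $ Suc 0 = a * v $ Suc 0 + b * w $ Suc 0"
    "M $$ (0,0) * w $ 0 + M $$ (0, Suc 0) * w $ Suc 0 = c * v $ 0 + d * w $ 0"
    "M $$ (Suc 0,0) * w $ 0 + M $$ (Suc 0, Suc 0) * w $ Suc 0 = c * v $ Suc 0 + d * w $ Suc 0"
    using arg_cong[OF Mv, of "\<lambda>x. x $ 0"] arg_cong[OF Mv, of "\<lambda>x. x $ Suc 0"]
      arg_cong[OF Mw, of "\<lambda>x. x $ 0"] arg_cong[OF Mw, of "\<lambda>x. x $ Suc 0"] v w
    by (simp_all add: idx)
  note eqs = this
  have "(M $$ (0,0) + M $$ (Suc 0, Suc 0)) * (v $ 0 * w $ Suc 0 - v $ Suc 0 * w $ 0)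
      = (M $$ (0,0) * v $ 0 + M $$ (0, Suc 0) * v $ Suc 0) * w $ Suc 0
      - (M $$ (0,0) * w $ 0 + M $$ (0, Suc 0) * w $ Suc 0) * v $ Suc 0
      - (M $$ (Suc 0,0) * v $ 0 + M $$ (Suc 0, Suc 0) * v $ Suc 0) * w $ 0
      + (M $$ (Suc 0,0) * w $ 0 + M $$ (Suc 0, Suc 0) * w $ Suc 0) * v $ 0"
    by (simp add: algebra_simps)
  also have "\<dots> = (a + d) * (v $ 0 * w $ Suc 0 - v $ Suc 0 * w $ 0)"
    unfolding eqs by (simp add: algebra_simps)
  finally have "(M $$ (0,0) + M $$ (Suc 0, Suc 0)) * (v $ 0 * w $ Suc 0 - v $ Suc 0 * w $ 0)
      = (a + d) * (v $ 0 * w $ Suc 0 - v $ Suc 0 * w $ 0)"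
    .
  then show ?thesis using indep M by (simp add: mat_trace2)
qed

lemma dim_le_1_of_multiples:
  fixes v :: "complex vec"
  assumes "v \<in> carrier_vec n" "\<And>x. x \<in> carrier_vec n \<Longrightarrow> \<exists>c. \<forall>i<n. x $ i = c * v $ i"
  shows "n \<le> 1"
proof (rule ccontr)
  assume n: "\<not> n \<le> 1"
  obtain c where "\<forall>i<n. unit_vec n 0 $ i = c * v $ i" using assms(2)[of "unit_vec n 0"] by auto
  then have c: "c * v $ 0 = 1" "c * v $ 1 = 0" using n by (auto dest: spec[of _ 0] spec[of _ 1])
  obtain d where "\<forall>i<n. unit_vec n 1 $ i = d * v $ i" using assms(2)[of "unit_vec n 1"] by auto
  then have d: "d * v $ 1 = 1" using n by (auto dest: spec[of _ 1])
  show False using c d by auto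
qed

text \<open>Expanding the first two unit vectors makes a product of two 2x2 determinants equal to 1,
  so both are nonzero. A third coordinate would then vanish on \<open>v\<close> and on
  \<open>w\<close>, and the third unit vector would be out of reach.\<close>

lemma dim_of_span2:
  fixes v w :: "complex vec"
  assumes "v \<in> carrier_vec n" "w \<in> carrier_vec n" and "n \<ge> 2"
    and "\<And>x. x \<in> carrier_vec n \<Longrightarrow> \<exists>a b. \<forall>i<n. x $ i = a * v $ i + b * w $ i"
  shows "n = 2 \<and> v $ 0 * w $ 1 \<noteq> v $ 1 * w $ 0"
proof -
  obtain a b where "\<forall>i<n. unit_vec n 0 $ i = a * v $ i + b * w $ i"
    using assms(4)[of "unit_vec n 0"] by auto
  then have ab: "a * v $ 0 + b * w $ 0 = 1" "a * v $ 1 + b * w $ 1 = 0" "n > 2 \<Longrightarrow> a * v $ 2 + b * w $ 2 = 0"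
    using assms(3) by (auto dest: spec[of _ 0] spec[of _ 1] spec[of _ 2])
  obtain c d where "\<forall>i<n. unit_vec n 1 $ i = c * v $ i + d * w $ i"
    using assms(4)[of "unit_vec n 1"] by auto
  then have cd: "c * v $ 0 + d * w $ 0 = 0" "c * v $ 1 + d * w $ 1 = 1" "n > 2 \<Longrightarrow> c * v $ 2 + d * w $ 2 = 0"
    using assms(3) by (auto dest: spec[of _ 0] spec[of _ 1] spec[of _ 2])
  have "(a * d - b * c) * (v $ 0 * w $ 1 - v $ 1 * w $ 0) = (a * v $ 0 + b * w $ 0) * (c * v $ 1 + d * w $ 1)
      - (a * v $ 1 + b * w $ 1) * (c * v $ 0 + d * w $ 0)" by (simp add: algebra_simps)
  then have "(a * d - b * c) * (v $ 0 * w $ 1 - v $ 1 * w $ 0) = 1" unfolding ab(1,2) cd(1,2) by simp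
  then have 1: "v $ 0 * w $ 1 \<noteq> v $ 1 * w $ 0" and det: "a * d - b * c \<noteq> 0" by auto
  have "\<not> n > 2"
  proof
    assume n: "n > 2"
    have "(a * d - b * c) * v $ 2 = 0" "(a * d - b * c) * w $ 2 = 0"
    proof -
      have "(a * d - b * c) * v $ 2 = (a * v $ 2 + b * w $ 2) * d - (c * v $ 2 + d * w $ 2) * b"
        "(a * d - b * c) * w $ 2 = (c * v $ 2 + d * w $ 2) * a - (a * v $ 2 + b * w $ 2) * c"
        by (simp_all add: algebra_simps)
      then show "(a * d - b * c) * v $ 2 = 0" "(a * d - b * c) * w $ 2 = 0"
        using ab(3)[OF n] cd(3)[OF n] by simp_all
    qed
    then have "v $ 2 = 0" "w $ 2 = 0" using det by simp_all
    moreover obtain e f where "\<forall>i<n. unit_vec n 2 $ i = e * v $ i + f * w $ i"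
      using assms(4)[of "unit_vec n 2"] by auto
    then have "e * v $ 2 + f * w $ 2 = 1" using n by (auto dest: spec[of _ 2])
    ultimately show False by simp
  qed
  with 1 assms(3) show ?thesis by auto
qed

text \<open>A parameter \<open>\<sigma> = 0\<close> gives the two-dimensional characters, and
  \<open>\<sigma> = 1\<close>, \<open>\<sigma> = -1\<close> the linear ones; the formula evaluates
  \<open>cos (n t)\<close> at the rotation or reflection with parameter \<open>t\<close>.\<close>

definition dihedral_char :: "nat \<Rightarrow> nat \<Rightarrow> complex \<Rightarrow> class_fun" where
  "dihedral_char m n \<sigma> = (\<lambda>w\<in>dihedral m. (if det w = 1 then 2 - \<sigma>\<^sup>2 else \<sigma>) *
     (((w $$ (0, 0) + \<i> * w $$ (1, 0)) ^ n + (w $$ (0, 0) - \<i> * w $$ (1, 0)) ^ n) / 2))"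

text \<open>With \<sigma> = 0 the range of \<open>n\<close> is that of the two-dimensional
  characters. The linear ones sit at the two ends of this range: \<open>n = 0\<close> for trivial
  and sign, and \<open>2 * n = m\<close>, for even m only, for \<chi>_r and \<chi>_r'.\<close>

definition valid_param :: "nat \<Rightarrow> nat \<Rightarrow> complex \<Rightarrow> bool" where
  "valid_param m n \<sigma> \<longleftrightarrow>
     \<sigma> = 0 \<and> 0 < n \<and> 2 * n < m \<or> \<sigma> \<in> {1, - 1} \<and> (n = 0 \<or> 2 * n = m)"

section \<open>Character values as cosines\<close>

definition ccos :: "nat \<Rightarrow> nat \<Rightarrow> complex" where
  "ccos m l = of_real (cos (2 * pi * real l / real m))"

text \<open>\<open>rotation t\<close> and \<open>reflection t\<close> share the first column (cos t,
  sin t). De Moivre's formula therefore recovers cos (n t) from the entries that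
  \<open>dihedral_char\<close> reads, without choosing an angle for the matrix.\<close>

lemma cis_power_sum:
  "((of_real (cos t) + \<i> * of_real (sin t)) ^ n + (of_real (cos t) - \<i> * of_real (sin t)) ^ n) / 2
     = complex_of_real (cos (real n * t))"
proof -
  have 1: "of_real (cos t) + \<i> * of_real (sin t) = cis t"
    by (simp add: complex_eq_iff)
  have 2: "of_real (cos t) - \<i> * of_real (sin t) = cis (- t)"
    by (simp add: complex_eq_iff)
  show ?thesis unfolding 1 2 DeMoivre by (simp add: complex_eq_iff)
qed

lemma dihedral_char_rot:
  "k < m \<Longrightarrow> dihedral_char m n \<sigma> (rot m k) = (2 - \<sigma>\<^sup>2) * ccos m (n * k)"
  using cis_power_sum[of "2 * pi * real k / real m" n]
  by (simp add: dihedral_char_def rot_in_dihedral) (simp add: rot_def ccos_def mult_ac)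

lemma dihedral_char_mirror:
  "k < m \<Longrightarrow> dihedral_char m n \<sigma> (mirror m k) = \<sigma> * ccos m (n * k)"
  using cis_power_sum[of "2 * pi * real k / real m" n]
  by (simp add: dihedral_char_def mirror_in_dihedral) (simp add: mirror_def ccos_def mult_ac)

lemma restrict_eq_dihedral_char:
  assumes "\<And>k. k < m \<Longrightarrow> f (rot m k) = (2 - \<sigma>\<^sup>2) * ccos m (n * k)"
    and "\<And>k. k < m \<Longrightarrow> f (mirror m k) = \<sigma> * ccos m (n * k)"
  shows "restrict f (dihedral m) = dihedral_char m n \<sigma>"
proof
  fix w show "restrict f (dihedral m) w = dihedral_char m n \<sigma> w"
  proof (cases "w \<in> dihedral m")
    case True
    then show ?thesis
      using assms by (auto simp: dihedral_eq dihedral_char_rot dihedral_char_mirror rot_in_dihedral mirror_in_dihedral)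
  qed (simp add: dihedral_char_def)
qed

lemma ccos_0 [simp]: "ccos m 0 = 1"
  by (simp add: ccos_def)

lemma triv_char_eq: "triv_char m = dihedral_char m 0 1"
  unfolding triv_char_def by (rule restrict_eq_dihedral_char) simp_all

lemma sign_char_eq: "sign_char m = dihedral_char m 0 (- 1)"
  unfolding sign_char_def by (rule restrict_eq_dihedral_char) simp_all

lemma refl_char_eq: "refl_char m = dihedral_char m 1 0"
  unfolding refl_char_def
  by (rule restrict_eq_dihedral_char) (simp_all add: mat_trace2, simp_all add: rot_def mirror_def ccos_def)

section \<open>Roots of unity as eigenvalues of the generating rotation\<close>

lemma unity_root_cis:
  fixes z :: complex
  assumes "z ^ m = 1" "0 < m"
  obtains j where "j < m" "z = cis (2 * pi * real j / real m)"
proof -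
  have "z \<in> (\<lambda>k. cis (2 * pi * real k / real m)) ` {..<m}"
    using bij_betw_roots_unity[OF assms(2)] assms(1) by (auto simp: bij_betw_def)
  then show thesis using that by auto
qed

lemma cis_reflect:
  assumes "j \<le> m" "0 < m"
  shows "cis (2 * pi * real (m - j) / real m) = cis (- (2 * pi * real j / real m))"
proof -
  have "cis (2 * pi * real (m - j) / real m) = cis (2 * pi - 2 * pi * real j / real m)"
    using assms by (simp add: of_nat_diff field_simps)
  then show ?thesis by (simp add: complex_eq_iff)
qed

text \<open>The sum is symmetric in z and its inverse, so an exponent j may be replaced by m - j;
  one of the two is below m/2. The condition on the square excludes the exponents 0 and m/2.\<close>

lemma unity_root_plus_inverse:
  fixes z :: complex
  assumes "z ^ m = 1" "0 < m" "z\<^sup>2 \<noteq> 1"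
  obtains n where "0 < n" "2 * n < m" "\<And>k. z ^ k + inverse z ^ k = 2 * ccos m (n * k)"
proof -
  have main: "z ^ k + inverse z ^ k = 2 * ccos m (n * k)"
    if "z = cis (2 * pi * real n / real m) \<or> inverse z = cis (2 * pi * real n / real m)" for n k
  proof -
    have "cis t ^ k + inverse (cis t) ^ k = 2 * of_real (cos (real k * t))" for t
      by (simp add: cis_inverse DeMoivre complex_eq_iff)
    then have *: "y ^ k + inverse y ^ k = 2 * ccos m (n * k)" if "y = cis (2 * pi * real n / real m)" for y
      unfolding that by (simp add: ccos_def mult_ac)
    show ?thesis using that by (metis * add.commute inverse_inverse_eq)
  qed
  obtain j where j: "j < m" "z = cis (2 * pi * real j / real m)"
    using unity_root_cis[OF assms(1,2)] .
  have "j \<noteq> 0" by (rule notI) (use assms(3) j(2) in simp)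
  have "2 * j \<noteq> m"
  proof
    assume "2 * j = m"
    then have "2 * pi * real j / real m = pi" using assms(2) by (auto simp: field_simps)
    then show False using assms(3) j(2) by simp
  qed
  show thesis
  proof (cases "2 * j < m")
    case True
    show ?thesis by (rule that[of j]) (use main j True \<open>j \<noteq> 0\<close> in auto)
  next
    case False
    have "inverse z = cis (2 * pi * real (m - j) / real m)"
      unfolding j(2) cis_inverse by (rule cis_reflect[symmetric]) (use j in auto)
    then show ?thesis
      by (intro that[of "m - j"]) (use main False \<open>2 * j \<noteq> m\<close> j \<open>j \<noteq> 0\<close> in auto)
  qed
qed

text \<open>Here z is 1 or -1, and -1 is an m-th root of unity only for even m; these are the
  exponents 0 and m/2.\<close>

lemma unity_root_involution:
  fixes z :: complex
  assumes "z ^ m = 1" "0 < m" "z\<^sup>2 = 1"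
  obtains n where "n = 0 \<or> 2 * n = m" "\<And>k. z ^ k = ccos m (n * k)"
proof (cases "z = 1")
  case True
  then show ?thesis using that[of 0] by simp
next
  case False
  then have z: "z = -1" using assms(3) by (simp add: power2_eq_1_iff)
  then have "even m" using assms(1) by (metis neg_one_odd_power one_neq_neg_one)
  then obtain r where r: "m = 2 * r" by blast
  have "2 * pi * real (r * k) / real m = real k * pi" for k
    using assms(2) r by simp
  then have "ccos m (r * k) = (-1) ^ k" for k unfolding ccos_def by simp
  then show ?thesis using that[of r] z r by simp
qed

lemma smult_eq_smult_imp_eq:
  fixes v :: "complex vec"
  assumes "v \<in> carrier_vec n" "v \<noteq> 0\<^sub>v n" "a \<cdot>\<^sub>v v = b \<cdot>\<^sub>v v"
  shows "a = b"
proof (rule ccontr)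
  assume "a \<noteq> b"
  have "v $ i = 0" if "i < n" for i
    using arg_cong[OF assms(3), of "\<lambda>x. x $ i"] that assms(1) \<open>a \<noteq> b\<close> by simp
  then have "v = 0\<^sub>v n" using assms(1) by (intro eq_vecI) auto
  with assms(2) show False ..
qed

lemma trace_dim_1:
  fixes M :: "complex mat"
  assumes "M \<in> carrier_mat 1 1" "x \<in> carrier_vec 1" "x \<noteq> 0\<^sub>v 1" "M *\<^sub>v x = c \<cdot>\<^sub>v x"
  shows "mat_trace M = c"
proof -
  have "x $ 0 \<noteq> 0"
  proof
    assume "x $ 0 = 0"
    then have "x = 0\<^sub>v 1" using assms(2) by (intro eq_vecI) auto
    with assms(3) show False ..
  qed
  moreover have "M $$ (0, 0) * x $ 0 = c * x $ 0"
    using arg_cong[OF assms(4), of "\<lambda>y. y $ 0"] assms(1,2) by (simp add: scalar_prod_def)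
  ultimately show ?thesis using assms(1) by (simp add: mat_trace_def)
qed

text \<open>Start from an eigenvector \<open>v\<close> of the generating rotation, with eigenvalue
  \<zeta>. Its image \<open>w\<close> under a reflection has the inverse eigenvalue, so the span of
  both is invariant. If \<zeta> differs from its inverse, \<open>v\<close> and \<open>w\<close> form
  a basis; otherwise a common eigenvector of rotation and reflection exists and the module is a
  line.\<close>

lemma irr_subset_dihedral_char:
  assumes "\<chi> \<in> irr m" and m: "m \<ge> 2"
  obtains n \<sigma> where "valid_param m n \<sigma>" "\<chi> = dihedral_char m n \<sigma>"
proof -
  obtain N \<rho> where irr: "irreducible_representation m N \<rho>"
    and \<chi>: "\<chi> = restrict (\<lambda>w. mat_trace (\<rho> w)) (dihedral m)"
    using assms(1) by (auto simp: irr_def)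
  have N: "N > 0" and carr: "\<And>g. g \<in> dihedral m \<Longrightarrow> \<rho> g \<in> carrier_mat N N"
    and one: "\<rho> (rot m 0) = 1\<^sub>m N"
    and hom: "\<And>g h. g \<in> dihedral m \<Longrightarrow> h \<in> dihedral m \<Longrightarrow> \<rho> (g * h) = \<rho> g * \<rho> h"
    using irr by (auto simp: irreducible_representation_def representation_def rot_0)
  define A where "A = \<rho> (rot m 1)"
  define B where "B = \<rho> (mirror m 0)"
  have A: "A \<in> carrier_mat N N" and B: "B \<in> carrier_mat N N"
    using m by (auto simp: A_def B_def intro!: carr rot_in_dihedral mirror_in_dihedral)
  have homv: "\<rho> (g * h) *\<^sub>v x = \<rho> g *\<^sub>v (\<rho> h *\<^sub>v x)"
    if "g \<in> dihedral m" "h \<in> dihedral m" "x \<in> carrier_vec N" for g h x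
    using that by (simp add: hom) (rule assoc_mult_mat_vec, auto intro: carr)
  have rot_pow: "\<rho> (rot m k) *\<^sub>v x = c ^ k \<cdot>\<^sub>v x"
    if "k < m" "x \<in> carrier_vec N" "A *\<^sub>v x = c \<cdot>\<^sub>v x" for k x c
    using that(1)
  proof (induction k)
    case 0
    then show ?case using that(2) by (simp add: one)
  next
    case (Suc k)
    have "\<rho> (rot m (Suc k)) *\<^sub>v x = A *\<^sub>v (\<rho> (rot m k) *\<^sub>v x)"
      using homv[of "rot m 1" "rot m k" x] Suc.prems that(2) m
      by (simp add: rot_in_dihedral rot_mult A_def)
    also have "\<dots> = A *\<^sub>v (c ^ k \<cdot>\<^sub>v x)" using Suc by simp
    also have "\<dots> = c ^ Suc k \<cdot>\<^sub>v x"
      using A that(2,3) by (simp add: mult_mat_vec smult_smult_assoc mult.commute)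
    finally show ?case .
  qed
  have refl_apply: "\<rho> (mirror m k) *\<^sub>v x = \<rho> (rot m k) *\<^sub>v (B *\<^sub>v x)"
    if "k < m" "x \<in> carrier_vec N" for k x
    using homv[of "rot m k" "mirror m 0" x] that m
    by (simp add: rot_in_dihedral mirror_in_dihedral rot_mult_mirror B_def)
  obtain \<zeta> where "\<zeta> \<in> spectrum A" using spectrum_non_empty[OF A N] by auto
  then obtain v where v: "v \<in> carrier_vec N" "v \<noteq> 0\<^sub>v N" and Av: "A *\<^sub>v v = \<zeta> \<cdot>\<^sub>v v"
    using A by (auto simp: spectrum_def eigenvalue_def eigenvector_def)
  \<comment> \<open>\<open>rot_pow\<close> stops below \<open>m\<close>, so the relation making
    \<zeta> an m-th root of unity needs one more multiplication by hand.\<close>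
  have "1\<^sub>m N *\<^sub>v v = A *\<^sub>v (\<rho> (rot m (m - 1)) *\<^sub>v v)"
    using homv[of "rot m 1" "rot m (m - 1)" v] v(1) m rot_add_period[of m 0]
    by (simp add: rot_in_dihedral rot_mult A_def one)
  also have "\<dots> = A *\<^sub>v (\<zeta> ^ (m - 1) \<cdot>\<^sub>v v)" using rot_pow[OF _ v(1) Av, of "m - 1"] m by simp
  also have "\<dots> = \<zeta> ^ m \<cdot>\<^sub>v v"
    using A v Av m by (simp add: mult_mat_vec smult_smult_assoc flip: power_Suc2)
  finally have "\<zeta> ^ m \<cdot>\<^sub>v v = 1 \<cdot>\<^sub>v v" using v by simp
  then have \<zeta>: "\<zeta> ^ m = 1" using smult_eq_smult_imp_eq v by blast
  then have "\<zeta> \<noteq> 0" using m by (auto simp: power_0_left)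
  have \<zeta>_inv: "\<zeta> ^ (m - 1) = inverse \<zeta>"
    using \<zeta> \<open>\<zeta> \<noteq> 0\<close> m by (cases m) (simp_all add: field_simps)
  define w where "w = B *\<^sub>v v"
  have w: "w \<in> carrier_vec N" using B v by (simp add: w_def)
  have Bw: "B *\<^sub>v w = v"
    using homv[of "mirror m 0" "mirror m 0" v] v m
    by (simp add: mirror_in_dihedral mirror_mult_mirror one w_def B_def)
  have w0: "w \<noteq> 0\<^sub>v N" using Bw v B by auto
  have "A *\<^sub>v w = \<rho> (rot m 1 * mirror m 0) *\<^sub>v v"
    using homv[of "rot m 1" "mirror m 0" v] v m
    by (simp add: rot_in_dihedral mirror_in_dihedral A_def B_def w_def)
  also have "rot m 1 * mirror m 0 = mirror m 0 * rot m (m - 1)"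
    using mirror_0_mult_rot[of "m - 1" m] m by simp
  also have "\<rho> \<dots> *\<^sub>v v = B *\<^sub>v (\<rho> (rot m (m - 1)) *\<^sub>v v)"
    using homv[of "mirror m 0" "rot m (m - 1)" v] v m
    by (simp add: rot_in_dihedral mirror_in_dihedral B_def)
  also have "\<dots> = inverse \<zeta> \<cdot>\<^sub>v w"
    using rot_pow[OF _ v(1) Av, of "m - 1"] m B v by (simp add: \<zeta>_inv[unfolded One_nat_def] mult_mat_vec w_def)
  finally have Aw: "A *\<^sub>v w = inverse \<zeta> \<cdot>\<^sub>v w" .
  show thesis
  proof (cases "\<zeta>\<^sup>2 = 1")
    case True
    then have inv: "inverse \<zeta> = \<zeta>" by (simp add: power2_eq_square inverse_unique)
    \<comment> \<open>Now the rotation acts on \<open>v\<close> and \<open>w\<close> by the same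
      scalar. The vector \<open>v + w\<close> is fixed by the reflection; if it is zero, then
      \<open>v\<close> itself is negated.\<close>
    obtain x \<sigma> where x: "x \<in> carrier_vec N" "x \<noteq> 0\<^sub>v N" and Ax: "A *\<^sub>v x = \<zeta> \<cdot>\<^sub>v x"
      and Bx: "B *\<^sub>v x = \<sigma> \<cdot>\<^sub>v x" and \<sigma>: "\<sigma> \<in> {1, - 1}"
    proof (cases "v + w = 0\<^sub>v N")
      case False
      show ?thesis
      proof (rule that[of "v + w" 1])
        show "A *\<^sub>v (v + w) = \<zeta> \<cdot>\<^sub>v (v + w)"
          using A v w Av Aw by (simp add: mult_add_distrib_mat_vec inv smult_add_distrib_vec)
        show "B *\<^sub>v (v + w) = 1 \<cdot>\<^sub>v (v + w)"
          using B v w Bw by (simp add: mult_add_distrib_mat_vec comm_add_vec[of v N w] flip: w_def)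
      qed (use v w False in auto)
    next
      case True
      have "w $ i = - v $ i" if "i < N" for i
        using arg_cong[OF True, of "\<lambda>x. x $ i"] that v w by (simp add: eq_neg_iff_add_eq_0 add.commute)
      then have "w = - 1 \<cdot>\<^sub>v v" using v w by (intro eq_vecI) auto
      then show ?thesis using that[of v "- 1"] v Av by (simp add: w_def)
    qed
    have rx: "\<rho> (rot m k) *\<^sub>v x = \<zeta> ^ k \<cdot>\<^sub>v x" if "k < m" for k
      using rot_pow[OF that x(1) Ax] .
    have fx: "\<rho> (mirror m k) *\<^sub>v x = (\<sigma> * \<zeta> ^ k) \<cdot>\<^sub>v x" if "k < m" for k
      using refl_apply[OF that x(1)] rx[OF that] carr[OF rot_in_dihedral[OF that]] x
      by (simp add: Bx mult_mat_vec smult_smult_assoc)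
    \<comment> \<open>Brings the eigenvector equations into the two-vector form of
      \<open>irreducible_span2\<close>, applied with both vectors equal to \<open>x\<close>.\<close>
    have comb: "c \<cdot>\<^sub>v x = c \<cdot>\<^sub>v x + 0 \<cdot>\<^sub>v x" for c using x by (intro eq_vecI) auto
    have "\<exists>a b. \<rho> g *\<^sub>v x = a \<cdot>\<^sub>v x + b \<cdot>\<^sub>v x" if "g \<in> dihedral m" for g
      using that rx fx comb by (fastforce simp: dihedral_eq)
    then have mult: "\<exists>c. \<forall>i<N. y $ i = c * x $ i" if "y \<in> carrier_vec N" for y
      using irreducible_span2[OF irr x x(1) _ _ that] by (metis distrib_right)
    have "N = 1" using dim_le_1_of_multiples[OF x(1) mult] N by simp
    obtain n where n: "n = 0 \<or> 2 * n = m" "\<And>k. \<zeta> ^ k = ccos m (n * k)"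
      using unity_root_involution[OF \<zeta> _ True] m by auto
    have "\<chi> = dihedral_char m n \<sigma>" unfolding \<chi>
    proof (rule restrict_eq_dihedral_char)
      fix k assume k: "k < m"
      show "mat_trace (\<rho> (rot m k)) = (2 - \<sigma>\<^sup>2) * ccos m (n * k)"
        using trace_dim_1[OF _ _ _ rx[OF k]] x carr[OF rot_in_dihedral[OF k]] \<sigma> n
        by (auto simp: \<open>N = 1\<close>)
      show "mat_trace (\<rho> (mirror m k)) = \<sigma> * ccos m (n * k)"
        using trace_dim_1[OF _ _ _ fx[OF k]] x carr[OF mirror_in_dihedral[OF k]] n
        by (auto simp: \<open>N = 1\<close>)
    qed
    moreover have "valid_param m n \<sigma>" using n \<sigma> by (auto simp: valid_param_def)
    ultimately show thesis by (rule that[rotated])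
  next
    case False
    have rv: "\<rho> (rot m k) *\<^sub>v v = \<zeta> ^ k \<cdot>\<^sub>v v + 0 \<cdot>\<^sub>v w"
      and rw: "\<rho> (rot m k) *\<^sub>v w = 0 \<cdot>\<^sub>v v + inverse \<zeta> ^ k \<cdot>\<^sub>v w"
      and fv: "\<rho> (mirror m k) *\<^sub>v v = 0 \<cdot>\<^sub>v v + inverse \<zeta> ^ k \<cdot>\<^sub>v w"
      and fw: "\<rho> (mirror m k) *\<^sub>v w = \<zeta> ^ k \<cdot>\<^sub>v v + 0 \<cdot>\<^sub>v w" if "k < m" for k
    proof -
      have 1: "a \<cdot>\<^sub>v v + 0 \<cdot>\<^sub>v w = a \<cdot>\<^sub>v v" "0 \<cdot>\<^sub>v v + a \<cdot>\<^sub>v w = a \<cdot>\<^sub>v w" for a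
        using v w by (auto intro!: eq_vecI)
      show "\<rho> (rot m k) *\<^sub>v v = \<zeta> ^ k \<cdot>\<^sub>v v + 0 \<cdot>\<^sub>v w"
        "\<rho> (rot m k) *\<^sub>v w = 0 \<cdot>\<^sub>v v + inverse \<zeta> ^ k \<cdot>\<^sub>v w"
        "\<rho> (mirror m k) *\<^sub>v v = 0 \<cdot>\<^sub>v v + inverse \<zeta> ^ k \<cdot>\<^sub>v w"
        "\<rho> (mirror m k) *\<^sub>v w = \<zeta> ^ k \<cdot>\<^sub>v v + 0 \<cdot>\<^sub>v w"
        unfolding 1 using rot_pow[OF that v(1) Av] rot_pow[OF that w Aw]
          refl_apply[OF that v(1)] refl_apply[OF that w] Bw by (simp_all flip: w_def)
    qed
    have "\<exists>a b. \<rho> g *\<^sub>v v = a \<cdot>\<^sub>v v + b \<cdot>\<^sub>v w" "\<exists>a b. \<rho> g *\<^sub>v w = a \<cdot>\<^sub>v v + b \<cdot>\<^sub>v w"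
      if "g \<in> dihedral m" for g
      using that rv rw fv fw unfolding dihedral_eq by blast+
    then have span: "\<exists>a b. \<forall>i<N. y $ i = a * v $ i + b * w $ i" if "y \<in> carrier_vec N" for y
      using irreducible_span2[OF irr v w _ _ that] by metis
    \<comment> \<open>On a line, \<open>w\<close> would be a multiple of \<open>v\<close> and would
      have eigenvalue \<zeta> as well as its inverse.\<close>
    have "N \<noteq> 1"
    proof
      assume "N = 1"
      then have "v $ 0 \<noteq> 0" using v by (auto intro!: eq_vecI)
      then have wv: "w = (w $ 0 / v $ 0) \<cdot>\<^sub>v v" using v w \<open>N = 1\<close> by (intro eq_vecI) auto
      then have "A *\<^sub>v w = \<zeta> \<cdot>\<^sub>v w"
        by (metis A Av mult.commute mult_mat_vec smult_smult_assoc v(1))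
      then have "\<zeta> = inverse \<zeta>" using Aw smult_eq_smult_imp_eq[OF w w0] by metis
      then show False using False \<open>\<zeta> \<noteq> 0\<close> by (metis left_inverse power2_eq_square)
    qed
    then have "N = 2" and indep: "v $ 0 * w $ 1 \<noteq> v $ 1 * w $ 0"
      using dim_of_span2[OF v(1) w _ span] N by auto
    obtain n where n: "0 < n" "2 * n < m" "\<And>k. \<zeta> ^ k + inverse \<zeta> ^ k = 2 * ccos m (n * k)"
      using unity_root_plus_inverse[OF \<zeta> _ False] m by auto
    have "\<chi> = dihedral_char m n 0" unfolding \<chi>
    proof (rule restrict_eq_dihedral_char)
      fix k assume k: "k < m"
      show "mat_trace (\<rho> (rot m k)) = (2 - 0\<^sup>2) * ccos m (n * k)"
        using trace_of_basis[OF _ _ _ indep rv[OF k] rw[OF k]] carr[OF rot_in_dihedral[OF k]] v w n(3)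
        by (simp add: \<open>N = 2\<close>)
      show "mat_trace (\<rho> (mirror m k)) = 0 * ccos m (n * k)"
        using trace_of_basis[OF _ _ _ indep fv[OF k] fw[OF k]] carr[OF mirror_in_dihedral[OF k]] v w
        by (simp add: \<open>N = 2\<close>)
    qed
    moreover have "valid_param m n 0" using n by (auto simp: valid_param_def)
    ultimately show thesis by (rule that[rotated])
  qed
qed

text \<open>A sum over an infinite set is 0 in HOL; finiteness gives the matrix equation over
  \<open>irr m\<close> its intended meaning.\<close>

lemma finite_irr:
  assumes "m \<ge> 2"
  shows "finite (irr m)"
proof (rule finite_subset)
  show "irr m \<subseteq> (\<lambda>(n, \<sigma>). dihedral_char m n \<sigma>) ` ({..m} \<times> {0, 1, - 1})"
  proof
    fix \<chi> assume "\<chi> \<in> irr m"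
    then obtain n \<sigma> where "valid_param m n \<sigma>" "\<chi> = dihedral_char m n \<sigma>"
      using irr_subset_dihedral_char assms by blast
    then show "\<chi> \<in> (\<lambda>(n, \<sigma>). dihedral_char m n \<sigma>) ` ({..m} \<times> {0, 1, - 1})"
      by (auto simp: valid_param_def intro!: image_eqI[of _ _ "(n, \<sigma>)"])
  qed
qed simp

section \<open>Fake degrees\<close>

text \<open>For x l = z^l + z^-l and c = z + z^-1 this is a truncated generating function: the
  factor is (1 - z q)(1 - z^-1 q), and multiplying by it leaves only boundary terms.\<close>

lemma recurrence_sum_identity:
  fixes c q :: "'a::comm_ring_1" and x :: "nat \<Rightarrow> 'a"
  assumes "x 0 = 2" "x 1 = c" "\<And>l. c * x (Suc l) = x l + x (Suc (Suc l))"
  shows "(1 - c * q + q\<^sup>2) * (\<Sum>l\<le>n. x l * q ^ l)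
    = 2 - c * q + x n * q ^ (n + 2) - x (Suc n) * q ^ Suc n"
proof (induction n)
  case 0
  then show ?case using assms(1,2) by (simp add: algebra_simps power2_eq_square)
next
  case (Suc n)
  have "(1 - c * q + q\<^sup>2) * (\<Sum>l\<le>Suc n. x l * q ^ l)
      = 2 - c * q + x n * q ^ (n + 2) - x (Suc n) * q ^ Suc n + (1 - c * q + q\<^sup>2) * (x (Suc n) * q ^ Suc n)"
    using Suc by (simp add: distrib_left)
  also have "\<dots> = 2 - c * q + x (Suc n) * q ^ (n + 3) + (x n - c * x (Suc n)) * q ^ (n + 2)"
    by (simp add: algebra_simps power2_eq_square power_add eval_nat_numeral)
  also have "\<dots> = 2 - c * q + x (Suc n) * q ^ (n + 3) - x (Suc (Suc n)) * q ^ (n + 2)"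
    unfolding assms(3) by (simp add: algebra_simps)
  finally show ?case by (simp add: eval_nat_numeral)
qed

lemma ccos_eqI: "2 * pi * real l / real m = 2 * pi * real n / real m + 2 * pi \<Longrightarrow> ccos m l = ccos m n"
  by (simp add: ccos_def)

lemma ccos_add_period: "0 < m \<Longrightarrow> ccos m (n + m * j) = ccos m n"
proof (induction j)
  case (Suc j)
  then have "ccos m (n + m * Suc j) = ccos m (n + m * j)"
    by (intro ccos_eqI) (simp add: field_simps)
  with Suc show ?case by simp
qed simp

lemma ccos_mult: "l \<le> n \<Longrightarrow> 2 * (ccos m n * ccos m l) = ccos m (n + l) + ccos m (n - l)"
proof -
  assume "l \<le> n"
  then have "2 * pi * real (n - l) / real m = 2 * pi * real n / real m - 2 * pi * real l / real m"
    by (simp add: of_nat_diff diff_divide_distrib right_diff_distrib)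
  moreover have "2 * pi * real (n + l) / real m = 2 * pi * real n / real m + 2 * pi * real l / real m"
    by (simp add: add_divide_distrib distrib_left)
  ultimately show ?thesis unfolding ccos_def
    by (simp add: cos_add cos_diff flip: of_real_mult of_real_add) simp
qed

text \<open>Orthogonality of characters of the cyclic group: the real part of a geometric sum whose
  ratio is an m-th root of unity, equal to 1 exactly when m divides j.\<close>

lemma sum_ccos:
  assumes m: "0 < m"
  shows "(\<Sum>k<m. ccos m (j * k)) = (if m dvd j then of_nat m else 0)"
proof (cases "m dvd j")
  case True
  then obtain i where "j = m * i" by blast
  then have "ccos m (j * k) = 1" for k
    using ccos_add_period[OF m, of 0 "i * k"] by (simp add: mult.assoc)
  then show ?thesis using True by simp
next
  case False
  define i where "i = j mod m"
  have i: "0 < i" "i < m" using False m by (auto simp: i_def dvd_eq_mod_eq_0)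
  have "j * k = i * k + m * ((j div m) * k)" for k
    by (metis i_def distrib_right mod_mult_div_eq mult.assoc)
  then have "ccos m (j * k) = ccos m (i * k)" for k
    by (metis ccos_add_period[OF m])
  moreover define z where "z = cis (2 * pi * real i / real m)"
  have "ccos m (i * k) = of_real (Re (z ^ k))" for k
    by (simp add: ccos_def z_def DeMoivre mult_ac)
  ultimately have "(\<Sum>k<m. ccos m (j * k)) = of_real (Re (\<Sum>k<m. z ^ k))" by simp
  moreover have "z \<noteq> 1"
  proof
    assume "z = 1"
    then have "cos (2 * pi * real i / real m) = 1" "sin (2 * pi * real i / real m) = 0"
      by (simp_all add: z_def complex_eq_iff)
    then have "i = 0" using angle_inj[of i m 0] i by simp
    with i show False by simp
  qed
  moreover have "z ^ m = cis (2 * pi * real i)" using m by (simp add: z_def DeMoivre)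
  then have "z ^ m = 1" by (simp add: complex_eq_iff)
  ultimately show ?thesis using False by (simp add: sum_gp_strict)
qed

text \<open>The polynomial (q^2 - 1)(q^m - 1) / det(q - w) for the rotation w of index k. The
  subtracted 1 + q^m lowers the two end coefficients from 2 to 1.\<close>

definition cyc_quot :: "nat \<Rightarrow> nat \<Rightarrow> complex poly" where
  "cyc_quot m k = (\<Sum>l\<le>m. monom (2 * ccos m (k * l)) l) - (1 + monom 1 m)"

text \<open>By periodicity the boundary terms of \<open>recurrence_sum_identity\<close> at m become
  2 q^(m+2) - c q^(m+1). The end correction then cancels every term containing c.\<close>

lemma char_poly_rot_mult_cyc_quot:
  assumes m: "0 < m"
  shows "char_poly (rot m k) * cyc_quot m k = (monom 1 2 - 1) * (monom 1 m - 1)"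
proof -
  define q where "q = ([:0, 1:] :: complex poly)"
  define x where "x l = [:2 * ccos m (k * l):]" for l
  define c where "c = [:2 * ccos m k:]"
  have mon: "monom a l = [:a:] * q ^ l" for a l
    by (simp add: monom_altdef q_def)
  have rec: "c * x (Suc l) = x l + x (Suc (Suc l))" for l
    using ccos_mult[of k "k * Suc l" m] by (simp add: c_def x_def algebra_simps)
  have cp: "char_poly (rot m k) = 1 - c * q + q\<^sup>2"
    by (simp add: char_poly_rot c_def q_def ccos_def power2_eq_square one_pCons)
  have per: "x m = 2" "x (Suc m) = c"
    using ccos_add_period[OF m, of 0 k] ccos_add_period[OF m, of k k]
    by (simp_all add: x_def c_def mult.commute numeral_poly)
  have "char_poly (rot m k) * (\<Sum>l\<le>m. monom (2 * ccos m (k * l)) l)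
      = 2 - c * q + x m * q ^ (m + 2) - x (Suc m) * q ^ Suc m"
    unfolding cp mon
    using recurrence_sum_identity[of x c q m] rec by (simp add: x_def c_def numeral_poly)
  then have "char_poly (rot m k) * cyc_quot m k
      = 2 - c * q + 2 * q ^ (m + 2) - c * q ^ Suc m - (1 - c * q + q\<^sup>2) * (1 + q ^ m)"
    unfolding cyc_quot_def right_diff_distrib per by (simp add: cp mon)
  also have "\<dots> = (q\<^sup>2 - 1) * (q ^ m - 1)"
    by (simp add: algebra_simps power_add power2_eq_square)
  finally show ?thesis by (simp add: mon)
qed

text \<open>For 0 < 2n < m this is the fake degree of the n-th two-dimensional character. The
  invariance under replacing n by m - n reflects that the indices n and m - n give the same
  cosines.\<close>

definition pal :: "nat \<Rightarrow> nat \<Rightarrow> complex poly" where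
  "pal m n = monom 1 n + monom 1 (m - n)"

lemma coeff_cyc_quot:
  "coeff (cyc_quot m k) l =
     (if l \<le> m then 2 * ccos m (k * l) else 0) - (of_bool (l = 0) + of_bool (l = m))"
proof -
  have "coeff (\<Sum>i\<le>m. monom (2 * ccos m (k * i)) i) l = (\<Sum>i\<le>m. if i = l then 2 * ccos m (k * i) else 0)"
    by (simp add: coeff_sum)
  also have "\<dots> = (if l \<le> m then 2 * ccos m (k * l) else 0)"
    by (simp add: sum.delta)
  finally show ?thesis
    unfolding cyc_quot_def coeff_diff coeff_add coeff_1 coeff_monom by (simp add: of_bool_def eq_commute[of m])
qed

text \<open>A discrete cosine transform: by orthogonality only the coefficients with l = n or l = m
  - n survive. At l = 0 and l = m the two divisibility conditions coincide, and the end correction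
  of \<open>cyc_quot\<close> removes the double count.\<close>

lemma sum_cyc_quot:
  assumes m: "0 < m" and n: "n \<le> m"
  shows "(\<Sum>k<m. Polynomial.smult (ccos m (n * k)) (cyc_quot m k)) = Polynomial.smult (of_nat m) (pal m n)"
proof (rule poly_eqI)
  fix l
  have dvd: "m dvd j \<longleftrightarrow> j = 0 \<or> j = m \<or> j = 2 * m" if "j \<le> 2 * m" for j
  proof
    assume "m dvd j"
    then obtain i where "j = m * i" by blast
    with that m have "i \<le> 2" by simp
    then have "i = 0 \<or> i = 1 \<or> i = 2" by linarith
    then show "j = 0 \<or> j = m \<or> j = 2 * m" using \<open>j = m * i\<close> by auto
  qed auto
  show "coeff (\<Sum>k<m. Polynomial.smult (ccos m (n * k)) (cyc_quot m k)) l = coeff (Polynomial.smult (of_nat m) (pal m n)) l"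
  proof (cases "l \<le> m")
    case False
    then show ?thesis using n by (simp add: coeff_sum coeff_cyc_quot pal_def)
  next
    case True
    \<comment> \<open>\<open>e\<close> is the end correction in the coefficient of
      \<open>cyc_quot\<close>; \<open>u\<close> is the absolute difference of n and l.\<close>
    define e where "e = (of_bool (l = 0) + of_bool (l = m) :: complex)"
    define u where "u = (if l \<le> n then n - l else l - n)"
    have "ccos m (n * k) * (2 * ccos m (k * l)) = ccos m ((n + l) * k) + ccos m (u * k)" for k
      using ccos_mult[of "l * k" "n * k" m] ccos_mult[of "n * k" "l * k" m]
      by (auto simp: u_def algebra_simps)
    then have "coeff (\<Sum>k<m. Polynomial.smult (ccos m (n * k)) (cyc_quot m k)) l
        = (\<Sum>k<m. ccos m ((n + l) * k) + ccos m (u * k) - e * ccos m (n * k))"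
      using True by (simp add: coeff_sum coeff_cyc_quot e_def right_diff_distrib mult.commute)
    also have "\<dots> = (\<Sum>k<m. ccos m ((n + l) * k)) + (\<Sum>k<m. ccos m (u * k)) - e * (\<Sum>k<m. ccos m (n * k))"
      by (simp add: sum.distrib sum_subtractf sum_distrib_left)
    also have "\<dots> = of_nat m * (of_bool (m dvd n + l) + of_bool (m dvd u) - e * of_bool (m dvd n))"
      unfolding sum_ccos[OF m] by (simp add: of_bool_def algebra_simps)
    also have "of_bool (m dvd n + l) + of_bool (m dvd u) - e * of_bool (m dvd n)
        = (of_bool (l = n) + of_bool (l = m - n) :: complex)"
    proof -
      have d1: "m dvd n + l \<longleftrightarrow> n + l = 0 \<or> n + l = m \<or> n + l = 2 * m" using True n by (intro dvd) simp
      have "u \<le> m" using True n by (auto simp: u_def)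
      then have d2: "m dvd u \<longleftrightarrow> u = 0 \<or> u = m" using m dvd[of u] by auto
      have d3: "m dvd n \<longleftrightarrow> n = 0 \<or> n = m" using n m dvd[of n] by auto
      consider (zero) "l = 0" | (top) "l = m" "l \<noteq> 0" | (mid) "0 < l" "l < m" using True by linarith
      then show ?thesis
      proof cases
        case zero
        then have "u = n" by (simp add: u_def)
        moreover have "0 = m - n \<longleftrightarrow> n = m" using n by auto
        moreover have "0 = n \<longleftrightarrow> n = 0" "0 \<noteq> m" using m by auto
        ultimately show ?thesis using m unfolding e_def zero add_0_right d3 by (auto simp: of_bool_def)
      next
        case top
        have "u = m - n" using n top by (auto simp: u_def)
        then have "m dvd u \<longleftrightarrow> n = m \<or> n = 0" unfolding d2 using n m by auto
        moreover have "m dvd n + l \<longleftrightarrow> n = 0 \<or> n = m" unfolding d1 top using n m by auto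
        moreover have "m = m - n \<longleftrightarrow> n = 0" using n m by auto
        ultimately show ?thesis unfolding e_def d3 top(1) using m by (auto simp: of_bool_def)
      next
        case mid
        have "m dvd u \<longleftrightarrow> l = n" unfolding d2 using mid n by (auto simp: u_def)
        moreover have "m dvd n + l \<longleftrightarrow> l = m - n" unfolding d1 using mid n by auto
        ultimately show ?thesis using mid by (simp add: e_def)
      qed
    qed
    also have "of_nat m * (of_bool (l = n) + of_bool (l = m - n)) = coeff (Polynomial.smult (of_nat m) (pal m n)) l"
      unfolding pal_def coeff_smult coeff_add coeff_monom of_bool_def by auto
    finally show ?thesis .
  qed
qed

section \<open>From group sums to closed forms in q\<close>

lemma q_var_power: "q_var ^ k = to_fract (monom 1 k)"
proof -
  have "(to_fract p) ^ k = to_fract (p ^ k)" for p :: "complex poly"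
    by (induction k) simp_all
  then show ?thesis by (simp add: monom_altdef)
qed

lemma of_nat_fract: "(of_nat n :: complex poly fract) = to_fract [:of_nat n:]"
  by (metis of_nat_poly to_fract_def of_nat_fract)

text \<open>Moving the prefactor into each summand clears its denominator: a rotation contributes
  \<open>cyc_quot\<close>, while every reflection has characteristic polynomial q^2 - 1 and leaves
  q^m - 1, with the minus sign of its determinant.\<close>

lemma fake_degree_eq:
  assumes m: "0 < m"
  shows "fake_degree m f = to_fract (Polynomial.smult (1 / of_nat (2 * m))
    ((\<Sum>k<m. Polynomial.smult (f (rot m k)) (cyc_quot m k))
      - Polynomial.smult (\<Sum>k<m. f (mirror m k)) (monom 1 m - 1)))"
proof -
  define D where "D = (monom 1 2 - 1 :: complex poly)"
  define E where "E = (monom 1 m - 1 :: complex poly)"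
  have D: "D = [:- 1, 0, 1:]"
    by (simp add: D_def monom_altdef one_pCons power2_eq_square)
  have pref: "(q_var ^ 2 - 1) * (q_var ^ m - 1) = to_fract (D * E)"
    unfolding q_var_power by (simp add: D_def E_def)
  have sm: "to_fract (Polynomial.smult c p) = to_fract [:c:] * to_fract p" for c and p :: "complex poly"
    by (simp flip: to_fract_mult)
  have rot: "to_fract (D * E) * (to_fract [:det (rot m k) * f (rot m k):] / to_fract (char_poly (rot m k)))
      = to_fract (Polynomial.smult (f (rot m k)) (cyc_quot m k))" for k
  proof -
    have ne: "to_fract (char_poly (rot m k)) \<noteq> 0" by (simp add: char_poly_rot)
    have "D * E = char_poly (rot m k) * cyc_quot m k"
      unfolding D_def E_def by (rule char_poly_rot_mult_cyc_quot[OF m, symmetric])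
    then have "to_fract (D * E) = to_fract (char_poly (rot m k)) * to_fract (cyc_quot m k)" by simp
    then show ?thesis using ne by (simp add: sm)
  qed
  have refl: "to_fract (D * E) * (to_fract [:det (mirror m k) * f (mirror m k):] / to_fract (char_poly (mirror m k)))
      = to_fract (Polynomial.smult (- f (mirror m k)) E)" for k
  proof -
    have ne: "to_fract D \<noteq> 0" by (simp add: D)
    have "char_poly (mirror m k) = D" by (simp add: char_poly_mirror D)
    then show ?thesis unfolding sm to_fract_mult using ne by simp
  qed
  have "fake_degree m f = (\<Sum>w\<in>dihedral m. to_fract (D * E) * (to_fract [:det w * f w:] / to_fract (char_poly w))) / of_nat (2 * m)"
    unfolding fake_degree_def pref sum_distrib_left[symmetric] by simp
  also have "\<dots> = ((\<Sum>k<m. to_fract (Polynomial.smult (f (rot m k)) (cyc_quot m k)))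
      + (\<Sum>k<m. to_fract (Polynomial.smult (- f (mirror m k)) E))) / of_nat (2 * m)"
    unfolding sum_dihedral rot refl ..
  also have "\<dots> = to_fract ((\<Sum>k<m. Polynomial.smult (f (rot m k)) (cyc_quot m k))
      - Polynomial.smult (\<Sum>k<m. f (mirror m k)) E) / to_fract [:of_nat (2 * m):]"
    unfolding of_nat_fract by (simp add: to_fract_sum smult_sum sum_negf)
  also have "\<dots> = to_fract (Polynomial.smult (1 / of_nat (2 * m)) ((\<Sum>k<m. Polynomial.smult (f (rot m k)) (cyc_quot m k))
      - Polynomial.smult (\<Sum>k<m. f (mirror m k)) E))"
  proof -
    have "to_fract p / to_fract [:c:] = to_fract (Polynomial.smult (1 / c) p)" if "c \<noteq> 0" for c and p :: "complex poly"
      using that by (simp add: divide_eq_eq flip: to_fract_mult)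
    from this[of "of_nat (2 * m)"] m show ?thesis by (simp del: of_nat_mult to_fract_diff)
  qed
  finally show ?thesis by (simp only: E_def)
qed

text \<open>Two cosines appear because a product of two character values splits in this way;
  \<open>j = l\<close> handles a single character.\<close>

lemma fake_degree_cos_sum:
  assumes m: "0 < m" and "j \<le> m" "l \<le> m"
    and rot: "\<And>k. k < m \<Longrightarrow> f (rot m k) = a * (ccos m (j * k) + ccos m (l * k))"
    and refl: "\<And>k. k < m \<Longrightarrow> f (mirror m k) = b * (ccos m (j * k) + ccos m (l * k))"
  shows "fake_degree m f = to_fract (Polynomial.smult (a / 2) (pal m j + pal m l)
    - Polynomial.smult (b / 2 * (of_bool (m dvd j) + of_bool (m dvd l))) (monom 1 m - 1))"
proof -
  have "(\<Sum>k<m. Polynomial.smult (f (rot m k)) (cyc_quot m k))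
      = Polynomial.smult a ((\<Sum>k<m. Polynomial.smult (ccos m (j * k)) (cyc_quot m k))
        + (\<Sum>k<m. Polynomial.smult (ccos m (l * k)) (cyc_quot m k)))"
    by (simp add: rot smult_add_left smult_add_right distrib_left sum.distrib smult_sum2)
  also have "\<dots> = Polynomial.smult (of_nat m * a) (pal m j + pal m l)"
    unfolding sum_cyc_quot[OF m assms(2)] sum_cyc_quot[OF m assms(3)] by (simp add: smult_add_right mult.commute)
  finally have 1: "(\<Sum>k<m. Polynomial.smult (f (rot m k)) (cyc_quot m k)) = \<dots>" .
  have "(\<Sum>k<m. f (mirror m k)) = b * ((\<Sum>k<m. ccos m (j * k)) + (\<Sum>k<m. ccos m (l * k)))"
    by (simp add: refl distrib_left sum.distrib sum_distrib_left)
  also have "\<dots> = of_nat m * (b * (of_bool (m dvd j) + of_bool (m dvd l)))"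
    unfolding sum_ccos[OF m] by (simp add: of_bool_def algebra_simps)
  finally have 2: "(\<Sum>k<m. f (mirror m k)) = \<dots>" .
  have 3: "1 / of_nat (2 * m) * (of_nat m * x) = x / 2" for x :: complex
    using m by simp
  show ?thesis unfolding fake_degree_eq[OF m] 1 2 smult_diff_right smult_smult 3
    by (simp only: times_divide_eq_left)
qed

lemma fake_degree_dihedral_char:
  assumes "0 < m" "2 * n \<le> m"
  shows "fake_degree m (dihedral_char m n \<sigma>) = to_fract (Polynomial.smult ((2 - \<sigma>\<^sup>2) / 2) (pal m n)
    - Polynomial.smult (of_bool (n = 0) * \<sigma> / 2) (monom 1 m - 1))"
proof -
  have "m dvd n \<longleftrightarrow> n = 0" using assms by (auto dest: dvd_imp_le)
  moreover have "fake_degree m (dihedral_char m n \<sigma>) = to_fract (Polynomial.smult (((2 - \<sigma>\<^sup>2) / 2) / 2) (pal m n + pal m n)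
    - Polynomial.smult ((\<sigma> / 2) / 2 * (of_bool (m dvd n) + of_bool (m dvd n))) (monom 1 m - 1))"
    using assms by (intro fake_degree_cos_sum) (simp_all add: dihedral_char_rot dihedral_char_mirror)
  moreover have "pal m n + pal m n = Polynomial.smult 2 (pal m n)"
    by (simp flip: mult_2 add: numeral_poly)
  moreover have "(2 - \<sigma>\<^sup>2) / 2 / 2 * 2 = (2 - \<sigma>\<^sup>2) / 2" by simp
  ultimately show ?thesis by (simp only: smult_smult) (simp add: mult.commute)
qed

text \<open>The twist by the sign character reverses the reflection part, so the correction enters
  with a plus. The assumption n <= l keeps the natural subtraction honest;
  \<open>omega_commute\<close> covers the other order.\<close>

lemma omega_dihedral_char:
  assumes "0 < m" "2 * n \<le> m" "2 * l \<le> m" "n \<le> l"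
  shows "omega m (dihedral_char m n \<sigma>) (dihedral_char m l \<tau>) = q_var ^ m * to_fract
    (Polynomial.smult ((2 - \<sigma>\<^sup>2) * (2 - \<tau>\<^sup>2) / 4) (pal m (l + n) + pal m (l - n))
     + Polynomial.smult (\<sigma> * \<tau> / 4 * (of_bool (m dvd l + n) + of_bool (l = n))) (monom 1 m - 1))"
proof -
  have "m dvd l - n \<longleftrightarrow> l = n" using assms by (auto dest: dvd_imp_le)
  moreover have "fake_degree m (\<lambda>w. dihedral_char m n \<sigma> w * dihedral_char m l \<tau> w * sign_char m w)
    = to_fract (Polynomial.smult (((2 - \<sigma>\<^sup>2) * (2 - \<tau>\<^sup>2) / 2) / 2) (pal m (l + n) + pal m (l - n))
    - Polynomial.smult ((- (\<sigma> * \<tau>) / 2) / 2 * (of_bool (m dvd l + n) + of_bool (m dvd l - n))) (monom 1 m - 1))"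
  proof (rule fake_degree_cos_sum)
    fix k assume k: "k < m"
    have "ccos m ((l + n) * k) + ccos m ((l - n) * k) = 2 * (ccos m (l * k) * ccos m (n * k))"
      using ccos_mult[of "n * k" "l * k" m] assms(4) by (simp add: algebra_simps)
    then show "dihedral_char m n \<sigma> (rot m k) * dihedral_char m l \<tau> (rot m k) * sign_char m (rot m k)
        = (2 - \<sigma>\<^sup>2) * (2 - \<tau>\<^sup>2) / 2 * (ccos m ((l + n) * k) + ccos m ((l - n) * k))"
      "dihedral_char m n \<sigma> (mirror m k) * dihedral_char m l \<tau> (mirror m k) * sign_char m (mirror m k)
        = - (\<sigma> * \<tau>) / 2 * (ccos m ((l + n) * k) + ccos m ((l - n) * k))"
      using k by (simp_all add: sign_char_eq dihedral_char_rot dihedral_char_mirror)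
  qed (use assms in auto)
  ultimately show ?thesis by (simp add: omega_def)
qed

lemma omega_commute: "omega m \<chi> \<psi> = omega m \<psi> \<chi>"
  by (simp add: omega_def mult_ac)

section \<open>The matrix \<open>\<Omega>\<close>\<close>

lemma to_fract_pal: "to_fract (pal m n) = q_var ^ n + q_var ^ (m - n)"
  by (simp add: pal_def q_var_power)

section \<open>Orders of vanishing at q = 0\<close>

lemma q_power_dvd_to_fract: "q_power_dvd k (to_fract p) \<longleftrightarrow> (\<forall>i<k. coeff p i = 0)"
proof -
  have "q_power_dvd k (to_fract p) \<longleftrightarrow> (\<exists>g. p = monom 1 k * g)"
    unfolding q_power_dvd_def q_var_power by (simp flip: to_fract_mult)
  then show ?thesis by (simp add: monom_1_dvd_iff' flip: dvd_def)
qed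

lemma b_inv_eqI:
  assumes "fake_degree m \<chi> = to_fract p" "coeff p b \<noteq> 0" "\<And>i. i < b \<Longrightarrow> coeff p i = 0"
  shows "b_inv m \<chi> = b"
  unfolding b_inv_def assms(1) q_power_dvd_to_fract
  by (rule Greatest_equality) (use assms(2,3) in \<open>auto simp: not_less[symmetric]\<close>)

lemma b_inv_triv: "3 \<le> m \<Longrightarrow> b_inv m (triv_char m) = 0"
  unfolding triv_char_eq
  by (rule b_inv_eqI[OF fake_degree_dihedral_char]) (auto simp: pal_def)

lemma b_inv_sign: "3 \<le> m \<Longrightarrow> b_inv m (sign_char m) = m"
  unfolding sign_char_eq
  by (rule b_inv_eqI[OF fake_degree_dihedral_char]) (auto simp: pal_def)

lemma b_inv_dihedral_char:
  assumes "0 < n" "valid_param m n \<sigma>"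
  shows "b_inv m (dihedral_char m n \<sigma>) = n"
  by (rule b_inv_eqI[OF fake_degree_dihedral_char])
     (use assms in \<open>auto simp: pal_def valid_param_def\<close>)

section \<open>Entries of \<Omega> by type of character\<close>

lemma coeff_numeral_poly:
  "coeff (numeral k :: 'a::comm_semiring_1 poly) n = (if n = 0 then numeral k else 0)"
  "coeff (numeral k * p :: 'a::comm_semiring_1 poly) n = numeral k * coeff p n"
  by (simp_all add: numeral_poly coeff_pCons split: nat.split)

text \<open>A two-dimensional character is unchanged by tensoring with the sign, so the rows of
  trivial and sign agree on it.\<close>

lemma omega_triv_2dim:
  assumes "0 < l" "2 * l < m"
  shows "omega m (triv_char m) (dihedral_char m l 0) = q_var ^ m * (q_var ^ l + q_var ^ (m - l))"
    and "omega m (sign_char m) (dihedral_char m l 0) = q_var ^ m * (q_var ^ l + q_var ^ (m - l))"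
proof -
  have "Polynomial.smult (1 / 2) (pal m l + pal m l) = pal m l"
    by (rule poly_eqI) (simp add: coeff_numeral_poly)
  then show "omega m (triv_char m) (dihedral_char m l 0) = q_var ^ m * (q_var ^ l + q_var ^ (m - l))"
    and "omega m (sign_char m) (dihedral_char m l 0) = q_var ^ m * (q_var ^ l + q_var ^ (m - l))"
    unfolding triv_char_eq sign_char_eq to_fract_pal[symmetric] using assms
    by (simp_all add: omega_dihedral_char del: smult_add_right)
qed

text \<open>Tensoring with the sign swaps \<chi>_r and \<chi>_r', but both have fake degree
  q^r.\<close>

lemma omega_triv_1dim:
  assumes "0 < r" "m = 2 * r" "\<tau> \<in> {1, - 1}"
  shows "omega m (triv_char m) (dihedral_char m r \<tau>) = q_var ^ m * q_var ^ r"
    and "omega m (sign_char m) (dihedral_char m r \<tau>) = q_var ^ m * q_var ^ r"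
proof -
  have "Polynomial.smult (1 / 4) (pal m r + pal m r) = monom 1 r"
    by (rule poly_eqI) (simp add: pal_def assms(2) coeff_numeral_poly)
  moreover have "\<not> m dvd r" "\<tau>\<^sup>2 = 1" using assms by (auto dest: dvd_imp_le)
  ultimately show "omega m (triv_char m) (dihedral_char m r \<tau>) = q_var ^ m * q_var ^ r"
    and "omega m (sign_char m) (dihedral_char m r \<tau>) = q_var ^ m * q_var ^ r"
    unfolding triv_char_eq sign_char_eq q_var_power[of r] using assms(1,2)
    by (simp_all add: omega_dihedral_char del: smult_add_right)
qed

lemma omega_triv_sign:
  assumes "0 < m"
  shows "omega m (triv_char m) (sign_char m) = q_var ^ m"
    and "omega m (sign_char m) (sign_char m) = q_var ^ m * q_var ^ m"
proof -
  have "Polynomial.smult (1 / 4) (pal m 0 + pal m 0) + Polynomial.smult (- 1 / 2) (monom 1 m - 1) = 1"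
    "Polynomial.smult (1 / 4) (pal m 0 + pal m 0) + Polynomial.smult (1 / 2) (monom 1 m - 1) = monom 1 m"
    by (rule poly_eqI, use \<open>0 < m\<close> in \<open>auto simp: pal_def coeff_numeral_poly\<close>)+
  then show "omega m (triv_char m) (sign_char m) = q_var ^ m"
    and "omega m (sign_char m) (sign_char m) = q_var ^ m * q_var ^ m"
    unfolding triv_char_eq sign_char_eq using assms
    by (simp_all add: omega_dihedral_char q_var_power del: smult_add_right smult_diff_right to_fract_add to_fract_diff)
qed

text \<open>The product has constituents of indices l + n and l - n. The formula persists when these
  degenerate: index 0 stands for trivial plus sign, index m/2 for \<chi>_r plus \<chi>_r', and
  indices beyond m/2 fold back by the symmetry of \<open>pal\<close>.\<close>

lemma omega_2dim_2dim:
  assumes "0 < n" "n \<le> l" "2 * l < m"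
  shows "omega m (dihedral_char m n 0) (dihedral_char m l 0)
    = q_var ^ m * (q_var ^ (l + n) + q_var ^ (m - (l + n)) + q_var ^ (l - n) + q_var ^ (m - (l - n)))"
  using assms by (simp add: omega_dihedral_char to_fract_pal)

lemma omega_2dim_1dim:
  assumes "0 < n" "n < r" "m = 2 * r" "\<tau> \<in> {1, - 1}"
  shows "omega m (dihedral_char m n 0) (dihedral_char m r \<tau>)
    = q_var ^ m * (q_var ^ (r + n) + q_var ^ (r - n))"
proof -
  have "m - (r + n) = r - n" "m - (r - n) = r + n" using assms by auto
  then have "Polynomial.smult (1 / 2) (pal m (r + n) + pal m (r - n)) = monom 1 (r + n) + monom 1 (r - n)"
    by (intro poly_eqI) (simp add: pal_def coeff_numeral_poly)
  moreover have "\<tau>\<^sup>2 = 1" using assms by auto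
  ultimately show ?thesis using assms
    by (simp add: omega_dihedral_char q_var_power del: smult_add_right)
qed

text \<open>Equal characters multiply to the trivial one and different ones to the sign; after the
  sign twist the fake degree is q^m or 1. The off-diagonal 1 is what breaks proportionality to the
  trivial row.\<close>

lemma omega_1dim_1dim:
  assumes "0 < r" "m = 2 * r" "\<sigma> \<in> {1, - 1}" "\<tau> \<in> {1, - 1}"
  shows "omega m (dihedral_char m r \<sigma>) (dihedral_char m r \<tau>)
    = q_var ^ m * (if \<sigma> = \<tau> then q_var ^ m else 1)"
proof -
  have "0 < m" using assms by simp
  have "Polynomial.smult (1 / 4) (pal m m + pal m 0) + Polynomial.smult (- 1 / 2) (monom 1 m - 1) = 1"
    "Polynomial.smult (1 / 4) (pal m m + pal m 0) + Polynomial.smult (1 / 2) (monom 1 m - 1) = monom 1 m"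
    by (rule poly_eqI, use \<open>0 < m\<close> in \<open>auto simp: pal_def coeff_numeral_poly\<close>)+
  moreover have "\<sigma>\<^sup>2 = 1" "\<tau>\<^sup>2 = 1" "\<sigma> * \<tau> = (if \<sigma> = \<tau> then 1 else - 1)" using assms by auto
  moreover have "omega m (dihedral_char m r \<sigma>) (dihedral_char m r \<tau>) = q_var ^ m * to_fract
      (Polynomial.smult ((2 - \<sigma>\<^sup>2) * (2 - \<tau>\<^sup>2) / 4) (pal m m + pal m 0)
       + Polynomial.smult (\<sigma> * \<tau> / 4 * 2) (monom 1 m - 1))"
  proof -
    have "r + r = m" "2 * r \<le> m" using assms by auto
    then show ?thesis using omega_dihedral_char[of m r r \<sigma> \<tau>] \<open>0 < m\<close> by simp
  qed
  ultimately show ?thesis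
    by (simp add: q_var_power del: smult_add_right smult_diff_right to_fract_add to_fract_diff split: if_splits)
qed

text \<open>The coefficient of \<open>q ^ (2 * m)\<close> in \<open>\<Omega>\<close> is the multiplicity of the trivial
  character in \<open>\<chi> \<otimes> \<chi>'\<close>; so \<open>\<Omega>\<close> is \<open>q ^ (2 * m)\<close> times the identity, up to lower order.\<close>

lemma omega_leading_aux:
  assumes "0 < m" "valid_param m n \<sigma>" "valid_param m l \<tau>" "n \<le> l"
  obtains p where "omega m (dihedral_char m n \<sigma>) (dihedral_char m l \<tau>) = to_fract p"
    "degree p \<le> 2 * m" "coeff p (2 * m) = of_bool (n = l \<and> \<sigma> = \<tau>)"
proof -
  have n: "2 * n \<le> m" and l: "2 * l \<le> m" using assms by (auto simp: valid_param_def)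
  define W where "W = Polynomial.smult ((2 - \<sigma>\<^sup>2) * (2 - \<tau>\<^sup>2) / 4) (pal m (l + n) + pal m (l - n))
     + Polynomial.smult (\<sigma> * \<tau> / 4 * (of_bool (m dvd l + n) + of_bool (l = n))) (monom 1 m - 1)"
  have "degree W \<le> m"
    unfolding W_def pal_def using n l
    by (intro degree_add_le order.trans[OF degree_smult_le] degree_diff_le) (auto simp: degree_monom_eq)
  then have "degree (monom 1 m * W) \<le> 2 * m"
    by (intro order.trans[OF degree_mult_le]) (simp add: degree_monom_eq)
  moreover have "omega m (dihedral_char m n \<sigma>) (dihedral_char m l \<tau>) = to_fract (monom 1 m * W)"
    using omega_dihedral_char[of m n l \<sigma> \<tau>] assms(1,4) n l by (simp add: W_def q_var_power)
  moreover have "coeff W m = of_bool (n = l \<and> \<sigma> = \<tau>)"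
  proof -
    have dvd: "m dvd l + n \<longleftrightarrow> l + n = 0 \<or> l + n = m"
    proof
      assume "m dvd l + n"
      then obtain i where i: "l + n = m * i" by blast
      moreover have "i \<le> 1" 
      proof (rule ccontr)
        assume "\<not> i \<le> 1"
        then have "m * 2 \<le> m * i" by (intro mult_le_mono2) simp
        with i n l assms(1) show False by simp
      qed
      ultimately show "l + n = 0 \<or> l + n = m" by (cases i) auto
    qed auto
    have "coeff (pal m (l + n) + pal m (l - n)) m = of_bool (l + n = 0) + of_bool (l + n = m) + of_bool (l = n)"
      using n l assms(1,4) by (auto simp: pal_def of_bool_def)
    then have W: "coeff W m = (2 - \<sigma>\<^sup>2) * (2 - \<tau>\<^sup>2) / 4 * (of_bool (l + n = 0) + of_bool (l + n = m) + of_bool (l = n))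
        + \<sigma> * \<tau> / 4 * (of_bool (l + n = 0 \<or> l + n = m) + of_bool (l = n))"
      unfolding W_def dvd using assms(1) by (simp only: coeff_add[of "Polynomial.smult _ _"] coeff_smult coeff_diff) simp
    show ?thesis
    proof (cases "l = n")
      case False
      then have "l + n \<noteq> 0" "l + n \<noteq> m" using n l assms(4) by auto
      then show ?thesis using False unfolding W by auto
    next
      case True
      show ?thesis
      \<comment> \<open>A linear character has exactly one of l + n = 0 and l + n = m, so the
        coefficient is (1 + \<sigma>\<tau>)/2; a two-dimensional one has neither, and the weight 2 *
        2 / 4 gives 1.\<close>
      proof (cases "n = 0 \<or> 2 * n = m")
        case lin: True
        then have "\<sigma> \<in> {1, - 1}" "\<tau> \<in> {1, - 1}" "l + n = 0 \<or> l + n = m" "l + n = 0 \<longleftrightarrow> \<not> l + n = m"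
          using assms True by (auto simp: valid_param_def)
        then show ?thesis using True unfolding W by auto
      next
        case False
        then have "\<sigma> = 0" "\<tau> = 0" "l + n \<noteq> 0" "l + n \<noteq> m"
          using assms True by (auto simp: valid_param_def)
        then show ?thesis using True unfolding W by simp
      qed
    qed
  qed
  then have "coeff (monom 1 m * W) (2 * m) = of_bool (n = l \<and> \<sigma> = \<tau>)"
    by (simp add: coeff_monom_mult)
  ultimately show thesis using that by blast
qed

lemma omega_leading:
  assumes "2 \<le> m" "\<chi> \<in> irr m" "\<psi> \<in> irr m"
  obtains p where "omega m \<chi> \<psi> = to_fract p" "degree p \<le> 2 * m" "coeff p (2 * m) = of_bool (\<chi> = \<psi>)"
proof -
  obtain n \<sigma> where n: "valid_param m n \<sigma>" and \<chi>: "\<chi> = dihedral_char m n \<sigma>"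
    using irr_subset_dihedral_char assms by blast
  \<comment> \<open>Equal characters are given the same parameters. Then \<open>eq\<close> holds
    without knowing that parameters are determined by the character.\<close>
  obtain l \<tau> where l: "valid_param m l \<tau>" "\<psi> = dihedral_char m l \<tau>" and eq: "\<chi> = \<psi> \<longleftrightarrow> n = l \<and> \<sigma> = \<tau>"
  proof (cases "\<chi> = \<psi>")
    case True
    then show ?thesis using that n \<chi> by blast
  next
    case False
    obtain l \<tau> where "valid_param m l \<tau>" "\<psi> = dihedral_char m l \<tau>"
      using irr_subset_dihedral_char assms by blast
    then show ?thesis using that False \<chi> by blast
  qed
  have m: "0 < m" using assms(1) by simp
  show thesis
  proof (cases "n \<le> l")
    case True
    from omega_leading_aux[OF m n l(1) True] obtain p
      where "omega m \<chi> \<psi> = to_fract p" "degree p \<le> 2 * m" "coeff p (2 * m) = of_bool (n = l \<and> \<sigma> = \<tau>)"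
      unfolding \<chi> l(2) by blast
    then show ?thesis using that[of p] eq by simp
  next
    case False
    then have "l \<le> n" by simp
    from omega_leading_aux[OF m l(1) n this] obtain p
      where "omega m \<psi> \<chi> = to_fract p" "degree p \<le> 2 * m" "coeff p (2 * m) = of_bool (l = n \<and> \<tau> = \<sigma>)"
      unfolding \<chi> l(2) by blast
    moreover have "l = n \<and> \<tau> = \<sigma> \<longleftrightarrow> \<chi> = \<psi>" using eq by auto
    ultimately show ?thesis using that[of p] by (simp add: omega_commute[of m \<chi>])
  qed
qed

section \<open>Green functions\<close>

lemma coeff_mult_bound:
  fixes p q :: "'a::comm_semiring_1 poly"
  assumes "degree p \<le> d" "degree q \<le> e"
  shows "coeff (p * q) (d + e) = coeff p d * coeff q e"
proof -
  have "coeff p i * coeff q (d + e - i) = (if i = d then coeff p d * coeff q e else 0)"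
    if "i \<le> d + e" for i
  proof (cases i d rule: linorder_cases)
    case less
    then have "degree q < d + e - i" using assms(2) that by linarith
    then show ?thesis using less by (simp add: coeff_eq_0)
  next
    case greater
    then have "coeff p i = 0" using assms(1) by (intro coeff_eq_0) simp
    then show ?thesis using greater by simp
  qed simp
  then have "coeff (p * q) (d + e) = (\<Sum>i\<le>d + e. if i = d then coeff p d * coeff q e else 0)"
    unfolding coeff_mult by (intro sum.cong) auto
  then show ?thesis by (simp add: sum.delta)
qed

text \<open>Take an entry of maximal degree e in a polynomial kernel vector. In the corresponding
  row of the product, the coefficient of q^(d+e) is the leading coefficient of that entry, because
  all other entries of the row have lower degree than d.\<close>

lemma det_neq_0_of_leading_identity:
  fixes A :: "'a::idom poly mat"
  assumes A: "A \<in> carrier_mat N N"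
    and deg: "\<And>i j. i < N \<Longrightarrow> j < N \<Longrightarrow> degree (A $$ (i, j)) \<le> d"
    and lead: "\<And>i j. i < N \<Longrightarrow> j < N \<Longrightarrow> coeff (A $$ (i, j)) d = of_bool (i = j)"
  shows "det A \<noteq> 0"
proof
  assume "det A = 0"
  then obtain v where v: "v \<in> carrier_vec N" "v \<noteq> 0\<^sub>v N" and Av: "A *\<^sub>v v = 0\<^sub>v N"
    using det_0_iff_vec_prod_zero[OF A] by blast
  define S where "S = {i. i < N \<and> v $ i \<noteq> 0}"
  have "S \<noteq> {}"
  proof
    assume "S = {}"
    then have "v = 0\<^sub>v N" using v(1) by (intro eq_vecI) (auto simp: S_def)
    with v(2) show False ..
  qed
  moreover have "finite S" by (simp add: S_def)
  ultimately have "Max ((\<lambda>j. degree (v $ j)) ` S) \<in> (\<lambda>j. degree (v $ j)) ` S"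
    by (intro Max_in) auto
  then obtain i where i: "i \<in> S" and "degree (v $ i) = Max ((\<lambda>j. degree (v $ j)) ` S)"
    by force
  then have max: "degree (v $ j) \<le> degree (v $ i)" if "j \<in> S" for j
    using that \<open>finite S\<close> by simp
  define e where "e = degree (v $ i)"
  have iN: "i < N" using i by (simp add: S_def)
  have dv: "degree (v $ j) \<le> e" if "j < N" for j
    using max[of j] that by (cases "v $ j = 0") (auto simp: S_def e_def)
  have "0 = coeff ((A *\<^sub>v v) $ i) (d + e)" using Av iN by simp
  also have "(A *\<^sub>v v) $ i = (\<Sum>j<N. A $$ (i, j) * v $ j)"
    using A v iN by (simp add: scalar_prod_def atLeast0LessThan)
  also have "coeff \<dots> (d + e) = (\<Sum>j<N. coeff (A $$ (i, j)) d * coeff (v $ j) e)"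
    unfolding coeff_sum by (intro sum.cong refl coeff_mult_bound deg dv) (use iN in auto)
  also have "\<dots> = (\<Sum>j<N. if j = i then coeff (v $ i) e else 0)"
    by (intro sum.cong) (auto simp: lead iN)
  also have "\<dots> = coeff (v $ i) e" using iN by (simp add: sum.delta)
  finally show False using i by (simp add: e_def S_def)
qed

text \<open>Determinants in P \<Lambda> P^t = \<Omega> show that det \<Lambda> is nonzero, so
  \<Lambda> has no left kernel. Enumerating the index set by a list makes matrix determinants
  available.\<close>

lemma middle_factor_injective:
  fixes P \<Lambda> \<Omega> :: "'b \<Rightarrow> 'b \<Rightarrow> 'a::idom poly fract"
  assumes fin: "finite I"
    and prod: "\<And>x y. x \<in> I \<Longrightarrow> y \<in> I \<Longrightarrow> (\<Sum>u\<in>I. \<Sum>v\<in>I. P x u * \<Lambda> u v * P y v) = \<Omega> x y"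
    and lead: "\<And>x y. x \<in> I \<Longrightarrow> y \<in> I \<Longrightarrow>
      \<exists>p. \<Omega> x y = to_fract p \<and> degree p \<le> d \<and> coeff p d = of_bool (x = y)"
    and ker: "\<And>v. v \<in> I \<Longrightarrow> (\<Sum>u\<in>I. z u * \<Lambda> u v) = 0"
    and u: "u \<in> I"
  shows "z u = 0"
proof -
  obtain xs where xs: "set xs = I" "distinct xs" using finite_distinct_list[OF fin] by blast
  define N where "N = length xs"
  have sum_I: "(\<Sum>u\<in>I. g u) = (\<Sum>i<N. g (xs ! i))" for g :: "'b \<Rightarrow> 'a poly fract"
    using sum.reindex_bij_betw[OF bij_betw_nth[OF xs(2) refl refl], of g] by (simp add: xs N_def)
  have inI: "xs ! i \<in> I" if "i < N" for i using that xs by (auto simp: N_def)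
  define M where "M f = mat N N (\<lambda>(i, j). f (xs ! i) (xs ! j))" for f :: "'b \<Rightarrow> 'b \<Rightarrow> 'a poly fract"
  have M: "M f \<in> carrier_mat N N" for f by (simp add: M_def)
  have "M P * M \<Lambda> * transpose_mat (M P) = M \<Omega>"
  proof (rule eq_matI)
    fix i j assume "i < dim_row (M \<Omega>)" "j < dim_col (M \<Omega>)"
    then have ij: "i < N" "j < N" by (simp_all add: M_def)
    have "(M P * M \<Lambda> * transpose_mat (M P)) $$ (i, j)
        = (\<Sum>l<N. (\<Sum>k<N. P (xs ! i) (xs ! k) * \<Lambda> (xs ! k) (xs ! l)) * P (xs ! j) (xs ! l))"
      using ij by (simp add: M_def scalar_prod_def atLeast0LessThan)
    also have "\<dots> = (\<Sum>k<N. \<Sum>l<N. P (xs ! i) (xs ! k) * \<Lambda> (xs ! k) (xs ! l) * P (xs ! j) (xs ! l))"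
      unfolding sum_distrib_right by (rule sum.swap)
    also have "\<dots> = \<Omega> (xs ! i) (xs ! j)"
      using prod[OF inI[OF ij(1)] inI[OF ij(2)]] by (simp add: sum_I)
    finally show "(M P * M \<Lambda> * transpose_mat (M P)) $$ (i, j) = M \<Omega> $$ (i, j)"
      using ij by (simp add: M_def)
  qed (simp_all add: M_def)
  moreover have "det (M \<Omega>) \<noteq> 0"
  proof -
    obtain p where p: "\<And>x y. x \<in> I \<Longrightarrow> y \<in> I \<Longrightarrow>
      \<Omega> x y = to_fract (p x y) \<and> degree (p x y) \<le> d \<and> coeff (p x y) d = of_bool (x = y)"
      using lead by metis
    define A where "A = mat N N (\<lambda>(i, j). p (xs ! i) (xs ! j))"
    \<comment> \<open>The leading coefficient argument needs degrees, so the determinant is computed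
      over polynomials and carried to fractions by this injection.\<close>
    interpret inj_comm_ring_hom "to_fract :: 'a poly \<Rightarrow> 'a poly fract"
      by (unfold_locales, auto)
    have "M \<Omega> = map_mat to_fract A"
      by (rule eq_matI) (auto simp: M_def A_def p inI)
    then have "det (M \<Omega>) = to_fract (det A)" by simp
    moreover have "det A \<noteq> 0"
      by (rule det_neq_0_of_leading_identity[of _ N d])
         (use xs p inI in \<open>auto simp: A_def N_def nth_eq_iff_index_eq\<close>)
    ultimately show ?thesis by simp
  qed
  moreover have "det (M P * M \<Lambda> * transpose_mat (M P)) = det (M P * M \<Lambda>) * det (transpose_mat (M P))"
    by (rule det_mult[OF mult_carrier_mat[OF M M]]) (simp add: M)
  moreover have "det (M P * M \<Lambda>) = det (M P) * det (M \<Lambda>)"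
    by (rule det_mult[OF M M])
  ultimately have "det (M \<Lambda>) \<noteq> 0" by auto
  then have det: "det (transpose_mat (M \<Lambda>)) \<noteq> 0" using det_transpose[OF M] by metis
  define v where "v = vec N (\<lambda>i. z (xs ! i))"
  have "transpose_mat (M \<Lambda>) *\<^sub>v v = 0\<^sub>v N"
  proof (rule eq_vecI)
    fix j assume "j < dim_vec (0\<^sub>v N :: 'a poly fract vec)"
    then have j: "j < N" by simp
    have "(transpose_mat (M \<Lambda>) *\<^sub>v v) $ j = (\<Sum>i<N. z (xs ! i) * \<Lambda> (xs ! i) (xs ! j))"
      using j by (simp add: M_def v_def scalar_prod_def atLeast0LessThan mult.commute)
    then show "(transpose_mat (M \<Lambda>) *\<^sub>v v) $ j = 0\<^sub>v N $ j"
      using ker[OF inI[OF j]] j by (simp add: sum_I)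
  qed (simp add: M_def)
  then have "v = 0\<^sub>v N"
    using det det_0_iff_vec_prod_zero[of "transpose_mat (M \<Lambda>)" N] M vec_carrier[of N] unfolding v_def
    by (metis transpose_carrier_mat)
  moreover obtain i where i: "i < N" "u = xs ! i" using u xs by (metis N_def in_set_conv_nth)
  ultimately show "z u = 0" by (metis index_vec index_zero_vec(1) v_def)
qed

section \<open>Supports, order and block structure of a fixed Springer correspondence\<close>

locale springer =
  fixes m :: nat and X :: "class_fun set set" and lt :: "class_fun set rel"
    and a :: "class_fun set \<Rightarrow> nat" and P \<Lambda> :: char_matrix
  assumes m3: "m \<ge> 3"
    and springer: "springer_correspondence m X lt a P \<Lambda>"
begin

lemma datum: "lusztig_shoji_datum m X lt a" and green: "green_system m X lt a P \<Lambda>"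
  using springer by (simp_all add: springer_correspondence_def)

lemma part: "partition_on (irr m) X"
  using datum by (simp add: lusztig_shoji_datum_def)

lemma fin: "finite (irr m)"
  using finite_irr m3 by simp

lemma class_subset: "C \<in> X \<Longrightarrow> C \<subseteq> irr m"
  using part by (auto simp: partition_on_def)

lemma finite_class: "C \<in> X \<Longrightarrow> finite C"
  using class_subset fin finite_subset by blast

lemma class_eq: "C \<in> X \<Longrightarrow> D \<in> X \<Longrightarrow> \<chi> \<in> C \<Longrightarrow> \<chi> \<in> D \<Longrightarrow> C = D"
  using part by (auto simp: partition_on_def disjoint_def)

lemma supp_eq: "C \<in> X \<Longrightarrow> \<chi> \<in> C \<Longrightarrow> supp X \<chi> = C"
  unfolding supp_def by (rule the_equality) (auto dest: class_eq)

lemma supp_mem: assumes "\<chi> \<in> irr m" shows "supp X \<chi> \<in> X" "\<chi> \<in> supp X \<chi>"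
proof -
  obtain C where "C \<in> X" "\<chi> \<in> C" using assms part by (auto simp: partition_on_def)
  then show "supp X \<chi> \<in> X" "\<chi> \<in> supp X \<chi>" using supp_eq by auto
qed

lemma lt_trans: "(C, D) \<in> lt \<Longrightarrow> (D, E) \<in> lt \<Longrightarrow> (C, E) \<in> lt"
  and lt_irrefl: "(C, C) \<notin> lt"
  and lt_total: "C \<in> X \<Longrightarrow> D \<in> X \<Longrightarrow> C \<noteq> D \<Longrightarrow> (C, D) \<in> lt \<or> (D, C) \<in> lt"
  and lt_a: "(C, D) \<in> lt \<Longrightarrow> a D \<le> a C"
  using datum unfolding lusztig_shoji_datum_def strict_linear_order_on_def
  by (meson transD, meson irreflD, simp add: total_on_def, blast)

text \<open>Allows back substitution to proceed from the smallest class upwards.\<close>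

lemma wf_lt: "wf lt"
proof (rule finite_acyclic_wf)
  have "finite X" using part fin by (metis finite_elements)
  then show "finite lt" using datum
    by (auto simp: lusztig_shoji_datum_def intro: finite_subset)
  have "trans lt" using lt_trans by (auto intro: transI)
  then show "acyclic lt" using lt_irrefl by (simp add: acyclic_def trancl_id)
qed

lemma P_eq_0: "\<chi> \<in> irr m \<Longrightarrow> \<psi> \<in> irr m \<Longrightarrow> (supp X \<chi>, supp X \<psi>) \<in> lt \<Longrightarrow> P \<chi> \<psi> = 0"
  and P_block: "C \<in> X \<Longrightarrow> \<chi> \<in> C \<Longrightarrow> \<psi> \<in> C \<Longrightarrow> P \<chi> \<psi> = (if \<chi> = \<psi> then q_var ^ a C else 0)"
  and \<Lambda>_eq_0: "\<chi> \<in> irr m \<Longrightarrow> \<psi> \<in> irr m \<Longrightarrow> supp X \<chi> \<noteq> supp X \<psi> \<Longrightarrow> \<Lambda> \<chi> \<psi> = 0"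
  and P_\<Lambda>_P: "\<chi> \<in> irr m \<Longrightarrow> \<psi> \<in> irr m \<Longrightarrow>
    (\<Sum>\<phi>\<in>irr m. \<Sum>\<theta>\<in>irr m. P \<chi> \<phi> * \<Lambda> \<phi> \<theta> * P \<psi> \<theta>) = omega m \<chi> \<psi>"
  using green by (simp_all add: green_system_def)

lemma \<Lambda>_injective:
  assumes "\<And>\<psi>. \<psi> \<in> irr m \<Longrightarrow> (\<Sum>\<phi>\<in>irr m. z \<phi> * \<Lambda> \<phi> \<psi>) = 0" "\<phi> \<in> irr m"
  shows "z \<phi> = 0"
proof (rule middle_factor_injective[OF fin P_\<Lambda>_P _ assms])
  fix \<chi> \<psi> assume "\<chi> \<in> irr m" "\<psi> \<in> irr m"
  then show "\<exists>p. omega m \<chi> \<psi> = to_fract p \<and> degree p \<le> 2 * m \<and> coeff p (2 * m) = of_bool (\<chi> = \<psi>)"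
    using omega_leading[of m \<chi> \<psi>] m3 by (metis le_trans numeral_le_iff semiring_norm(68,72,73))
qed

text \<open>Back substitution along the order. \<open>L\<close> need only be closed under the
  nonzero entries of P, not under the order itself; \<open>one_dim_row\<close> relies on this to
  leave out a class in the middle.\<close>

lemma row_vanishes:
  assumes L: "L \<subseteq> X"
    and closed: "\<And>\<chi> \<psi>. \<chi> \<in> \<Union>L \<Longrightarrow> \<psi> \<in> irr m \<Longrightarrow> P \<chi> \<psi> \<noteq> 0 \<Longrightarrow> \<psi> \<in> \<Union>L"
    and zero: "\<And>\<chi>. \<chi> \<in> \<Union>L \<Longrightarrow> (\<Sum>\<phi>\<in>irr m. \<Sum>\<psi>\<in>irr m. w \<phi> * \<Lambda> \<phi> \<psi> * P \<chi> \<psi>) = 0"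
    and "\<phi> \<in> \<Union>L"
  shows "w \<phi> = 0"
proof -
  have "C \<in> L \<Longrightarrow> \<forall>\<phi>\<in>C. w \<phi> = 0" for C
  proof (induction C rule: wf_induct_rule[OF wf_lt])
    case (1 C)
    then have C: "C \<in> X" using L by auto
    \<comment> \<open>Cutting \<open>w\<close> off outside C turns nondegeneracy of \<Lambda> into
      nondegeneracy of its block at C: the product with \<Lambda> vanishes outside C and is
      unchanged on C.\<close>
    define z where "z \<phi> = (if \<phi> \<in> C then w \<phi> else 0)" for \<phi>
    have "(\<Sum>\<phi>\<in>irr m. z \<phi> * \<Lambda> \<phi> \<psi>) = 0" if \<psi>: "\<psi> \<in> irr m" for \<psi>
    proof (cases "\<psi> \<in> C")
      case False
      have "\<Lambda> \<phi> \<psi> = 0" if "\<phi> \<in> C" for \<phi>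
        by (rule \<Lambda>_eq_0)
          (use that C \<psi> False class_subset supp_eq supp_mem in \<open>blast, blast, metis\<close>)
      then show ?thesis by (intro sum.neutral) (auto simp: z_def)
    next
      case True
      \<comment> \<open>Only the diagonal term survives: P is diagonal within C and zero towards
        larger classes, and on smaller classes the induction hypothesis kills \<open>w\<close>,
        hence also its product with \<Lambda>.\<close>
      have *: "(\<Sum>\<phi>\<in>irr m. w \<phi> * \<Lambda> \<phi> \<theta>) * P \<psi> \<theta>
          = (if \<theta> = \<psi> then (\<Sum>\<phi>\<in>irr m. w \<phi> * \<Lambda> \<phi> \<psi>) * q_var ^ a C else 0)"
        if \<theta>: "\<theta> \<in> irr m" for \<theta>
      proof (cases "\<theta> = \<psi> \<or> P \<psi> \<theta> = 0")
        case True
        then show ?thesis using P_block[OF C \<open>\<psi> \<in> C\<close> \<open>\<psi> \<in> C\<close>] by auto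
      next
        case False
        then have "\<theta> \<in> \<Union>L" using closed[of \<psi> \<theta>] \<theta> True 1 by blast
        then obtain D where D: "D \<in> L" "\<theta> \<in> D" by blast
        then have DX: "D \<in> X" using L by blast
        have "C \<noteq> D" using P_block[OF C True] D False by auto
        moreover have "(C, D) \<notin> lt"
          using P_eq_0[OF \<psi> \<theta>] False supp_eq[OF C True] supp_eq[OF DX D(2)] by auto
        ultimately have "(D, C) \<in> lt" using lt_total C DX by blast
        then have "\<forall>\<phi>\<in>D. w \<phi> = 0" using 1 D by blast
        then have "w \<phi> * \<Lambda> \<phi> \<theta> = 0" if "\<phi> \<in> irr m" for \<phi>
          using \<Lambda>_eq_0[OF that \<theta>] supp_eq[OF DX D(2)] supp_mem[OF that] by auto
        then show ?thesis using False by simp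
      qed
      have "0 = (\<Sum>\<phi>\<in>irr m. \<Sum>\<theta>\<in>irr m. w \<phi> * \<Lambda> \<phi> \<theta> * P \<psi> \<theta>)"
        using zero[of \<psi>] True \<open>C \<in> L\<close> by auto
      also have "\<dots> = (\<Sum>\<theta>\<in>irr m. (\<Sum>\<phi>\<in>irr m. w \<phi> * \<Lambda> \<phi> \<theta>) * P \<psi> \<theta>)"
        unfolding sum_distrib_right by (rule sum.swap)
      also have "\<dots> = (\<Sum>\<phi>\<in>irr m. w \<phi> * \<Lambda> \<phi> \<psi>) * q_var ^ a C"
        using fin \<psi> by (simp add: * sum.delta)
      finally have "(\<Sum>\<phi>\<in>irr m. w \<phi> * \<Lambda> \<phi> \<psi>) = 0" by simp
      moreover have "z \<phi> * \<Lambda> \<phi> \<psi> = w \<phi> * \<Lambda> \<phi> \<psi>" if "\<phi> \<in> irr m" for \<phi>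
        using \<Lambda>_eq_0[OF that \<psi>] supp_eq[OF C True] supp_mem[OF that] by (auto simp: z_def)
      then have "(\<Sum>\<phi>\<in>irr m. z \<phi> * \<Lambda> \<phi> \<psi>) = (\<Sum>\<phi>\<in>irr m. w \<phi> * \<Lambda> \<phi> \<psi>)"
        by (rule sum.cong[OF HOL.refl])
      ultimately show ?thesis by simp
    qed
    then have "z \<phi> = 0" if "\<phi> \<in> C" for \<phi>
      using \<Lambda>_injective[of z \<phi>] that class_subset[OF C] by blast
    then show ?case by (auto simp: z_def)
  qed
  with \<open>\<phi> \<in> \<Union>L\<close> show ?thesis by blast
qed

text \<open>One three-term pattern serves all row relations below; the literal factors 0 and 1 in
  their statements exist to match it.\<close>

lemma row_combination:
  assumes "\<chi> \<in> irr m" "s \<in> irr m" "t \<in> irr m" "u \<in> irr m"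
  shows "(\<Sum>\<phi>\<in>irr m. \<Sum>\<psi>\<in>irr m. (c * P s \<phi> - d * P t \<phi> - e * P u \<phi>) * \<Lambda> \<phi> \<psi> * P \<chi> \<psi>)
    = c * omega m s \<chi> - d * omega m t \<chi> - e * omega m u \<chi>"
proof -
  have *: "(c * P s \<phi> - d * P t \<phi> - e * P u \<phi>) * \<Lambda> \<phi> \<psi> * P \<chi> \<psi>
      = c * (P s \<phi> * \<Lambda> \<phi> \<psi> * P \<chi> \<psi>) - d * (P t \<phi> * \<Lambda> \<phi> \<psi> * P \<chi> \<psi>)
        - e * (P u \<phi> * \<Lambda> \<phi> \<psi> * P \<chi> \<psi>)" for \<phi> \<psi>
    by (simp add: left_diff_distrib mult.assoc)
  show ?thesis
    unfolding * sum_subtractf sum_distrib_left[symmetric]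
      P_\<Lambda>_P[OF assms(2,1)] P_\<Lambda>_P[OF assms(3,1)] P_\<Lambda>_P[OF assms(4,1)] ..
qed

section \<open>Consequences of the Springer conditions\<close>

lemma springer_classes: "\<forall>C\<in>X. a C = Min (b_inv m ` C) \<and> (\<exists>!\<chi>. springer_rep m C \<chi>)"
  and springer_special: "\<forall>\<chi>\<in>special_chars m. \<exists>C\<in>X. springer_rep m C \<chi>"
  and springer_families: "\<forall>F\<in>families m. \<forall>\<chi>\<in>F \<inter> special_chars m. \<forall>\<chi>'\<in>F - special_chars m.
    supp X \<chi>' = supp X \<chi> \<or> (supp X \<chi>', supp X \<chi>) \<in> lt"
proof -
  note conj = springer[unfolded springer_correspondence_def]
  show "\<forall>C\<in>X. a C = Min (b_inv m ` C) \<and> (\<exists>!\<chi>. springer_rep m C \<chi>)"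
    using conj by (elim conjE)
  show "\<forall>\<chi>\<in>special_chars m. \<exists>C\<in>X. springer_rep m C \<chi>"
    using conj by (elim conjE)
  show "\<forall>F\<in>families m. \<forall>\<chi>\<in>F \<inter> special_chars m. \<forall>\<chi>'\<in>F - special_chars m.
    supp X \<chi>' = supp X \<chi> \<or> (supp X \<chi>', supp X \<chi>) \<in> lt"
    using conj by (elim conjE)
qed

lemma springer_rep_unique: "C \<in> X \<Longrightarrow> springer_rep m C \<chi> \<Longrightarrow> springer_rep m C \<psi> \<Longrightarrow> \<chi> = \<psi>"
  and a_class: "C \<in> X \<Longrightarrow> a C = Min (b_inv m ` C)"
  and ex_springer_rep: "C \<in> X \<Longrightarrow> \<exists>\<chi>. springer_rep m C \<chi>"
  using springer_classes by blast+

lemma a_springer_rep: "C \<in> X \<Longrightarrow> springer_rep m C \<chi> \<Longrightarrow> a C = b_inv m \<chi>"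
  by (simp add: a_class springer_rep_def)

lemma a_le_b: "C \<in> X \<Longrightarrow> \<chi> \<in> C \<Longrightarrow> a C \<le> b_inv m \<chi>"
  using finite_class by (simp add: a_class)

lemma springer_rep_supp: "\<chi> \<in> special_chars m \<Longrightarrow> springer_rep m (supp X \<chi>) \<chi>"
  using springer_special supp_eq unfolding springer_rep_def by metis

text \<open>Irreducibility is supplied by the second Springer condition: a special character
  represents a class, and classes consist of irreducible characters.\<close>

lemma special_irr: "\<chi> \<in> special_chars m \<Longrightarrow> \<chi> \<in> irr m"
  using springer_special class_subset unfolding springer_rep_def by blast

lemma triv_irr: "triv_char m \<in> irr m" and sign_irr: "sign_char m \<in> irr m"
  and refl_irr: "refl_char m \<in> irr m"
  by (simp_all add: special_irr special_chars_def)

lemma irr_cases: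
  assumes "\<chi> \<in> irr m"
  obtains (triv) "\<chi> = triv_char m" "b_inv m \<chi> = 0"
  | (sign) "\<chi> = sign_char m" "b_inv m \<chi> = m"
  | (two_dim) l where "\<chi> = dihedral_char m l 0" "b_inv m \<chi> = l" "0 < l" "2 * l < m"
  | (one_dim) r \<tau> where "\<chi> = dihedral_char m r \<tau>" "b_inv m \<chi> = r" "0 < r" "m = 2 * r" "\<tau> \<in> {1, - 1}"
proof -
  have "m \<ge> 2" using m3 by simp
  then obtain n \<sigma> where v: "valid_param m n \<sigma>" and \<chi>: "\<chi> = dihedral_char m n \<sigma>"
    using irr_subset_dihedral_char assms by blast
  show thesis
  proof (cases "n = 0")
    case True
    then have "\<sigma> = 1 \<or> \<sigma> = - 1" using v by (auto simp: valid_param_def)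
    then show ?thesis using that(1,2) \<chi> True b_inv_triv[OF m3] b_inv_sign[OF m3]
      by (auto simp: triv_char_eq sign_char_eq)
  next
    case False
    then show ?thesis using that(3)[of n] that(4)[of n \<sigma>] v b_inv_dihedral_char[of n m \<sigma>] \<chi>
      by (auto simp: valid_param_def)
  qed
qed

lemma b_eq_m: "\<chi> \<in> irr m \<Longrightarrow> m \<le> b_inv m \<chi> \<Longrightarrow> \<chi> = sign_char m"
  by (erule irr_cases) (use m3 in auto)

text \<open>As a special character the sign represents its class, so every member has b at least m,
  which only the sign attains.\<close>

lemma sign_class: assumes "C \<in> X" "sign_char m \<in> C" shows "C = {sign_char m}"
proof -
  have "springer_rep m C (sign_char m)"
    using springer_rep_supp[of "sign_char m"] supp_eq[OF assms] by (simp add: special_chars_def)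
  then have "a C = m" using a_springer_rep[OF assms(1)] b_inv_sign[OF m3] by simp
  have "\<chi> = sign_char m" if "\<chi> \<in> C" for \<chi>
  proof (rule b_eq_m)
    show "\<chi> \<in> irr m" using class_subset[OF assms(1)] that by blast
    show "m \<le> b_inv m \<chi>" using a_le_b[OF assms(1) that] \<open>a C = m\<close> by simp
  qed
  then show ?thesis using assms(2) by blast
qed

text \<open>The value of \<open>a\<close> is m on the class of the sign and smaller on every other
  class. Order reversal makes this class the lowest, and triangularity clears its row.\<close>

lemma P_sign: assumes "\<chi> \<in> irr m" "\<chi> \<noteq> sign_char m" shows "P (sign_char m) \<chi> = 0"
proof -
  define E where "E = supp X (sign_char m)"
  have E: "E \<in> X" "E = {sign_char m}"
    using supp_mem[OF sign_irr] sign_class by (auto simp: E_def)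
  define D where "D = supp X \<chi>"
  have D: "D \<in> X" "\<chi> \<in> D" using supp_mem[OF assms(1)] by (auto simp: D_def)
  have "a E = m" using a_class[OF E(1)] b_inv_sign[OF m3] by (simp add: E(2))
  moreover have "a D < m" using a_le_b[OF D] b_eq_m[OF assms(1)] assms(2) 
    by (metis le_less_trans not_le)
  ultimately have "(D, E) \<notin> lt" using lt_a[of D E] by auto
  moreover have "D \<noteq> E" using D E assms(2) by auto
  ultimately have "(E, D) \<in> lt" using lt_total D E by blast
  then show ?thesis using P_eq_0[OF sign_irr assms(1)] by (simp add: E_def D_def)
qed

definition below :: "class_fun set \<Rightarrow> class_fun set set" where
  "below C = {D \<in> X. D = C \<or> (D, C) \<in> lt}"

lemma below_closed:
  assumes "C \<in> X" "\<chi> \<in> \<Union>(below C)" "\<psi> \<in> irr m" "P \<chi> \<psi> \<noteq> 0"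
  shows "supp X \<psi> \<in> below (supp X \<chi>)" "\<psi> \<in> \<Union>(below C)"
proof -
  obtain D where D: "D \<in> X" "D = C \<or> (D, C) \<in> lt" "\<chi> \<in> D" using assms(2) by (auto simp: below_def)
  have "\<chi> \<in> irr m" using class_subset D by blast
  then have "(D, supp X \<psi>) \<notin> lt" using P_eq_0[of \<chi> \<psi>] assms(3,4) supp_eq[OF D(1,3)] by auto
  then have *: "supp X \<psi> = D \<or> (supp X \<psi>, D) \<in> lt" using lt_total D(1) supp_mem[OF assms(3)] by blast
  then show "supp X \<psi> \<in> below (supp X \<chi>)"
    using supp_mem[OF assms(3)] supp_eq[OF D(1,3)] by (simp add: below_def)
  have "supp X \<psi> = C \<or> (supp X \<psi>, C) \<in> lt" using * D(2) lt_trans by blast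
  then show "\<psi> \<in> \<Union>(below C)" using supp_mem[OF assms(3)] by (auto simp: below_def)
qed

text \<open>Turns the order on classes into arithmetic: below a class with Springer representation
  of index n, all b-values are at least n, which fixes the sign of l - n in \<Omega>.\<close>

lemma below_b:
  assumes "C \<in> X" "\<chi> \<in> \<Union>(below C)"
  shows "\<chi> \<in> irr m" "a C \<le> b_inv m \<chi>"
proof -
  obtain D where D: "D \<in> X" "D = C \<or> (D, C) \<in> lt" "\<chi> \<in> D" using assms(2) by (auto simp: below_def)
  show "\<chi> \<in> irr m" using class_subset D by blast
  show "a C \<le> b_inv m \<chi>" using D(2) lt_a[of D C] a_le_b[OF D(1,3)] by auto
qed

end

text \<open>The first and last powers of q are q^n times q^l + q^(m-l); the middle two become q^l +
  q^(m-l) after multiplication by q^n. The outer factor q^n thus avoids the negative power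
  q^-n.\<close>

lemma two_dim_relation:
  fixes q M :: "'a::comm_ring_1"
  assumes "n \<le> l" "l + n \<le> m"
  shows "q ^ n * (M * (q ^ (l + n) + q ^ (m - (l + n)) + q ^ (l - n) + q ^ (m - (l - n))))
    - (q ^ n * q ^ n) * (M * (q ^ l + q ^ (m - l))) - 1 * (M * (q ^ l + q ^ (m - l))) = 0"
proof -
  obtain d where l: "l = n + d" using assms(1) le_Suc_ex by blast
  obtain k where "m = l + n + k" using assms(2) le_Suc_ex by blast
  then have "m = 2 * n + d + k" "m - (l + n) = k" "m - (l - n) = 2 * n + k" "m - l = n + k" "l - n = d"
    by (simp_all add: l)
  then show ?thesis unfolding l by (simp add: power_add power_mult power2_eq_square algebra_simps)
qed

section \<open>Rows of P at Springer representations\<close>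

context springer
begin

text \<open>The conclusion reaches all classes below C, not only C; the special piece of
  \<open>refl_char\<close> needs this range. The sign is excluded because there its own row of P
  does not vanish.\<close>

lemma two_dim_row:
  assumes C: "C \<in> X" and s: "springer_rep m C (dihedral_char m n 0)"
    and n: "0 < n" "2 * n < m" and \<phi>: "\<phi> \<in> \<Union>(below C)" "\<phi> \<noteq> sign_char m"
  shows "P (dihedral_char m n 0) \<phi> = q_var ^ n * P (triv_char m) \<phi>"
proof -
  let ?s = "dihedral_char m n 0"
  have s_irr: "?s \<in> irr m" using s C class_subset by (auto simp: springer_rep_def)
  have aC: "a C = n"
    using a_springer_rep[OF C s] b_inv_dihedral_char[of n m 0] n by (simp add: valid_param_def)
  have "q_var ^ n * P ?s \<phi> - (q_var ^ n * q_var ^ n) * P (triv_char m) \<phi> - 1 * P (sign_char m) \<phi> = 0"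
  proof (rule row_vanishes[where L = "below C"])
    fix \<chi> assume \<chi>: "\<chi> \<in> \<Union>(below C)"
    note \<chi>_irr = below_b(1)[OF C \<chi>]
    have "q_var ^ n * omega m ?s \<chi> - (q_var ^ n * q_var ^ n) * omega m (triv_char m) \<chi> - 1 * omega m (sign_char m) \<chi> = 0"
      using \<chi>_irr
    proof (cases rule: irr_cases)
      case triv
      \<comment> \<open>Contradictory case: the trivial character has b = 0 < n.\<close>
      then show ?thesis using below_b(2)[OF C \<chi>] aC n by simp
    next
      case sign
      have "q_var ^ n * (q_var ^ m * (q_var ^ n + q_var ^ (m - n))) - (q_var ^ n * q_var ^ n) * q_var ^ m - 1 * (q_var ^ m * q_var ^ m) = 0"
      proof -
        have "q_var ^ n * q_var ^ (m - n) = q_var ^ m" using n by (simp flip: power_add)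
        then show ?thesis by (simp add: algebra_simps)
      qed
      then show ?thesis unfolding sign omega_commute[of m ?s]
        using omega_triv_2dim(2)[OF n] omega_triv_sign[of m] n by simp
    next
      case (two_dim l)
      then have "n \<le> l" using below_b(2)[OF C \<chi>] aC by simp
      then show ?thesis using two_dim two_dim_relation[of n l m q_var "q_var ^ m"]
          omega_2dim_2dim[OF n(1), of l m] omega_triv_2dim[of l m] by simp
    next
      case (one_dim r \<tau>)
      have "n < r" using one_dim n by simp
      then have "q_var ^ n * q_var ^ (r - n) = q_var ^ r" by (simp flip: power_add)
      then have "q_var ^ n * (q_var ^ m * (q_var ^ (r + n) + q_var ^ (r - n))) - (q_var ^ n * q_var ^ n) * (q_var ^ m * q_var ^ r) - 1 * (q_var ^ m * q_var ^ r) = 0"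
        by (simp add: algebra_simps mult_2 power_add)
      then show ?thesis using one_dim omega_2dim_1dim[OF n(1) \<open>n < r\<close>, of m \<tau>] omega_triv_1dim[of r m \<tau>] by simp
    qed
    then show "(\<Sum>\<phi>\<in>irr m. \<Sum>\<psi>\<in>irr m. (q_var ^ n * P ?s \<phi> - (q_var ^ n * q_var ^ n) * P (triv_char m) \<phi>
        - 1 * P (sign_char m) \<phi>) * \<Lambda> \<phi> \<psi> * P \<chi> \<psi>) = 0"
      unfolding row_combination[OF \<chi>_irr s_irr triv_irr sign_irr] .
  qed (use below_closed(2)[OF C] \<phi>(1) in \<open>auto simp: below_def\<close>)
  then have "q_var ^ n * (P ?s \<phi> - q_var ^ n * P (triv_char m) \<phi>) = 0"
    using P_sign[OF below_b(1)[OF C \<phi>(1)] \<phi>(2)] by (simp add: algebra_simps mult_2 power_add)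
  then show ?thesis by simp
qed

text \<open>The relation between the rows of \<open>\<chi>\<^sub>r\<close> and the trivial character fails at \<open>\<chi>\<^sub>r'\<close>;
  when the class of \<open>\<chi>\<^sub>r'\<close> lies below that of \<open>\<chi>\<^sub>r\<close>, it can be left out of the argument
  because \<open>P\<close> vanishes at \<open>(\<chi>\<^sub>r, \<chi>\<^sub>r')\<close>.\<close>

lemma one_dim_row:
  assumes C: "C \<in> X" and s: "springer_rep m C (dihedral_char m r \<sigma>)"
    and r: "0 < r" "m = 2 * r" and \<sigma>: "\<sigma> \<in> {1, - 1}" and \<phi>: "\<phi> \<in> C"
  shows "P (dihedral_char m r \<sigma>) \<phi> = q_var ^ r * P (triv_char m) \<phi>"
proof -
  let ?s = "dihedral_char m r \<sigma>" and ?s' = "dihedral_char m r (- \<sigma>)"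
  have \<sigma>': "- \<sigma> \<in> {1, - 1}" "\<sigma> \<noteq> - \<sigma>" using \<sigma> by auto
  have m0: "0 < m" using m3 by simp
  have sC: "?s \<in> C" using s by (simp add: springer_rep_def)
  have s_irr: "?s \<in> irr m" using sC C class_subset by auto
  have b: "b_inv m ?s = r" "b_inv m ?s' = r"
    using b_inv_dihedral_char[of r m] r \<sigma> \<sigma>' by (simp_all add: valid_param_def)
  have aC: "a C = r" using a_springer_rep[OF C s] b by simp
  have neq: "?s' \<noteq> ?s"
  proof
    assume "?s' = ?s"
    then have "?s' (mirror m 0) = ?s (mirror m 0)" by simp
    then show False using m3 \<sigma>' by (simp add: dihedral_char_mirror)
  qed
  have s'_sign: "?s' \<noteq> sign_char m" using b b_inv_sign[OF m3] r by auto
  \<comment> \<open>Both characters have b = r, so in a common class the minimum would be attained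
    twice.\<close>
  have s'_notin: "?s' \<notin> C"
  proof
    assume "?s' \<in> C"
    then have "springer_rep m C ?s'" using s b by (simp add: springer_rep_def)
    then show False using springer_rep_unique[OF C s] neq by simp
  qed
  have cases: "\<chi> = ?s \<or> \<chi> = ?s' \<or> \<chi> = sign_char m" if "\<chi> \<in> \<Union>(below C)" for \<chi>
    using below_b[OF C that] aC r \<sigma> by (elim irr_cases) auto
  have qq: "q_var ^ m = q_var ^ r * q_var ^ r" using r by (simp add: mult_2 power_add)
  have P0: "P ?s ?s' = 0" if s'_below: "?s' \<in> \<Union>(below C)"
  proof -
    obtain D where D: "D \<in> X" "?s' \<in> D" "(D, C) \<in> lt" using s'_below s'_notin by (auto simp: below_def)
    note s'_irr = below_b(1)[OF C s'_below]
    \<comment> \<open>At and below D the character \<open>?s\<close> is absent. On the remaining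
      possible columns, \<open>?s'\<close> and the sign, q^r times the row of \<open>?s\<close> in
      \<Omega> equals the row of the sign.\<close>
    have "q_var ^ r * P ?s ?s' - 0 * P (triv_char m) ?s' - 1 * P (sign_char m) ?s' = 0"
    proof (rule row_vanishes[where L = "below D"])
      fix \<chi> assume \<chi>: "\<chi> \<in> \<Union>(below D)"
      then obtain D' where D': "D' \<in> X" "\<chi> \<in> D'" "D' = D \<or> (D', D) \<in> lt" by (auto simp: below_def)
      then have D'C: "(D', C) \<in> lt" using D(3) lt_trans by blast
      then have "\<chi> \<in> \<Union>(below C)" using D' by (auto simp: below_def)
      moreover have "\<chi> \<noteq> ?s" using class_eq[OF C D'(1) sC] D'(2) D'C lt_irrefl by auto
      ultimately have \<chi>': "\<chi> = ?s' \<or> \<chi> = sign_char m" using cases by blast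
      note \<chi>_irr = below_b(1)[OF D(1) \<chi>]
      have "q_var ^ r * omega m ?s \<chi> - 0 * omega m (triv_char m) \<chi> - 1 * omega m (sign_char m) \<chi> = 0"
        using \<chi>'
      proof
        assume "\<chi> = ?s'"
        then show ?thesis using omega_1dim_1dim[OF r \<sigma> \<sigma>'(1)] omega_triv_1dim(2)[OF r \<sigma>'(1)] \<sigma>'(2)
          by (simp add: mult.commute)
      next
        assume "\<chi> = sign_char m"
        then show ?thesis using omega_triv_1dim(2)[OF r \<sigma>] omega_triv_sign[OF m0] omega_commute[of m ?s]
          by (simp add: qq mult_ac)
      qed
      then show "(\<Sum>\<phi>\<in>irr m. \<Sum>\<psi>\<in>irr m. (q_var ^ r * P ?s \<phi> - 0 * P (triv_char m) \<phi>
          - 1 * P (sign_char m) \<phi>) * \<Lambda> \<phi> \<psi> * P \<chi> \<psi>) = 0"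
        unfolding row_combination[OF \<chi>_irr s_irr triv_irr sign_irr] .
    qed (use below_closed(2)[OF D(1)] D in \<open>auto simp: below_def\<close>)
    then show ?thesis using P_sign[OF s'_irr s'_sign] by simp
  qed
  have "1 * P ?s \<phi> - q_var ^ r * P (triv_char m) \<phi> - 0 * P (sign_char m) \<phi> = 0"
  \<comment> \<open>The set stays closed without the class of \<open>?s'\<close>: the row of
    \<open>?s\<close> does not meet \<open>?s'\<close> by \<open>P0\<close>, nor does the row of the
    sign by \<open>P_sign\<close>. On the columns left, \<open>?s\<close> and the sign, the relation
    has no sign term.\<close>
  proof (rule row_vanishes[where L = "{D \<in> below C. ?s' \<notin> D}"])
    fix \<chi> assume "\<chi> \<in> \<Union>{D \<in> below C. ?s' \<notin> D}"
    then have \<chi>: "\<chi> \<in> \<Union>(below C)" "\<chi> \<noteq> ?s'" by auto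
    note \<chi>_irr = below_b(1)[OF C \<chi>(1)]
    have "\<chi> = ?s \<or> \<chi> = sign_char m" using cases \<chi> by blast
    then have "1 * omega m ?s \<chi> - q_var ^ r * omega m (triv_char m) \<chi> - 0 * omega m (sign_char m) \<chi> = 0"
    proof
      assume "\<chi> = ?s"
      then show ?thesis using omega_1dim_1dim[OF r \<sigma> \<sigma>] omega_triv_1dim(1)[OF r \<sigma>]
        by (simp add: qq mult_ac)
    next
      assume "\<chi> = sign_char m"
      then show ?thesis using omega_triv_1dim(2)[OF r \<sigma>] omega_triv_sign[OF m0] omega_commute[of m ?s]
        by (simp add: mult_ac)
    qed
    then show "(\<Sum>\<phi>\<in>irr m. \<Sum>\<psi>\<in>irr m. (1 * P ?s \<phi> - q_var ^ r * P (triv_char m) \<phi>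
        - 0 * P (sign_char m) \<phi>) * \<Lambda> \<phi> \<psi> * P \<chi> \<psi>) = 0"
      unfolding row_combination[OF \<chi>_irr s_irr triv_irr sign_irr] .
  next
    fix \<chi> \<psi> assume "\<chi> \<in> \<Union>{D \<in> below C. ?s' \<notin> D}" and \<psi>: "\<psi> \<in> irr m" "P \<chi> \<psi> \<noteq> 0"
    then have \<chi>: "\<chi> \<in> \<Union>(below C)" "\<chi> \<noteq> ?s'" by auto
    then have \<chi>': "\<chi> = ?s \<or> \<chi> = sign_char m" using cases by blast
    note \<psi>_below = below_closed(2)[OF C \<chi>(1) \<psi>]
    have "?s' \<notin> supp X \<psi>"
    proof
      assume *: "?s' \<in> supp X \<psi>"
      have "\<psi> \<noteq> sign_char m" using * sign_class supp_mem[OF \<psi>(1)] s'_sign by blast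
      moreover have "\<psi> \<noteq> ?s" using * supp_eq[OF C sC] s'_notin by auto
      ultimately have "\<psi> = ?s'" using cases[OF \<psi>_below] by blast
      then show False using \<chi>' P0 \<psi> \<psi>_below P_sign s'_sign by auto
    qed
    moreover have "supp X \<psi> \<in> below C"
      using \<psi>_below supp_eq by (auto simp: below_def)
    ultimately show "\<psi> \<in> \<Union>{D \<in> below C. ?s' \<notin> D}" using supp_mem[OF \<psi>(1)] by blast
  qed (use C \<phi> s'_notin in \<open>auto simp: below_def\<close>)
  then show ?thesis by simp
qed

text \<open>Back substitution on the lowest class alone, where the two rows of \<Omega> are
  proportional with factor q^m.\<close>

lemma sign_row: "P (sign_char m) (sign_char m) = q_var ^ m * P (triv_char m) (sign_char m)"
proof -
  have m0: "0 < m" using m3 by simp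
  have E: "supp X (sign_char m) = {sign_char m}" "{sign_char m} \<in> X"
    using supp_mem[OF sign_irr] sign_class by auto
  have "1 * P (sign_char m) (sign_char m) - q_var ^ m * P (triv_char m) (sign_char m) - 0 * P (sign_char m) (sign_char m) = 0"
  proof (rule row_vanishes[where L = "{{sign_char m}}" and \<phi> = "sign_char m"
        and w = "\<lambda>\<phi>. 1 * P (sign_char m) \<phi> - q_var ^ m * P (triv_char m) \<phi> - 0 * P (sign_char m) \<phi>"])
    fix \<chi> assume "\<chi> \<in> \<Union>{{sign_char m}}"
    then have \<chi>: "\<chi> = sign_char m" by simp
    show "(\<Sum>\<phi>\<in>irr m. \<Sum>\<psi>\<in>irr m. (1 * P (sign_char m) \<phi> - q_var ^ m * P (triv_char m) \<phi>
        - 0 * P (sign_char m) \<phi>) * \<Lambda> \<phi> \<psi> * P \<chi> \<psi>) = 0"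
      unfolding \<chi> row_combination[OF sign_irr sign_irr triv_irr sign_irr]
      using omega_triv_sign[OF m0] by simp
  next
    fix \<chi> \<psi> assume "\<chi> \<in> \<Union>{{sign_char m}}" "\<psi> \<in> irr m" "P \<chi> \<psi> \<noteq> 0"
    then show "\<psi> \<in> \<Union>{{sign_char m}}" using P_sign[of \<psi>] by blast
  qed (use E in auto)
  then show ?thesis by simp
qed

lemma springer_row:
  assumes C: "C \<in> X" and s: "springer_rep m C s" and \<phi>: "\<phi> \<in> C"
  shows "P s \<phi> = q_var ^ a C * P (triv_char m) \<phi>"
proof -
  have sC: "s \<in> C" using s by (simp add: springer_rep_def)
  then have "s \<in> irr m" using C class_subset by blast
  note aC = a_springer_rep[OF C s]
  from \<open>s \<in> irr m\<close> show ?thesis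
  proof (cases rule: irr_cases)
    case triv
    then show ?thesis using aC by simp
  next
    case sign
    then have "C = {sign_char m}" using sign_class[OF C] sC by simp
    then show ?thesis using sign_row sign aC \<phi> by simp
  next
    case (two_dim l)
    have "\<phi> \<noteq> sign_char m"
    proof
      assume "\<phi> = sign_char m"
      then have "s = sign_char m" using sign_class[OF C] \<phi> sC by blast
      then show False using two_dim b_inv_sign[OF m3] by simp
    qed
    then show ?thesis using two_dim_row[OF C, of l \<phi>] s two_dim \<phi> C aC by (auto simp: below_def)
  next
    case (one_dim r \<tau>)
    then show ?thesis using one_dim_row[OF C, of r \<tau> \<phi>] s \<phi> aC by simp
  qed
qed

lemma triv_row:
  assumes "\<phi> \<in> irr m"
  shows "P (triv_char m) \<phi> = (if springer_rep m (supp X \<phi>) \<phi> then 1 else 0)"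
proof -
  define C where "C = supp X \<phi>"
  have C: "C \<in> X" "\<phi> \<in> C" using supp_mem[OF assms] by (auto simp: C_def)
  obtain s where s: "springer_rep m C s" using ex_springer_rep[OF C(1)] by blast
  then have "q_var ^ a C * P (triv_char m) \<phi> = (if s = \<phi> then q_var ^ a C else 0)"
    using springer_row[OF C(1) s C(2)] P_block[OF C(1) _ C(2), of s] by (simp add: springer_rep_def)
  then have "P (triv_char m) \<phi> = (if s = \<phi> then 1 else 0)" by (auto split: if_splits)
  moreover have "s = \<phi> \<longleftrightarrow> springer_rep m C \<phi>" using s springer_rep_unique[OF C(1)] by blast
  ultimately show ?thesis by (simp add: C_def)
qed

section \<open>Special pieces\<close>

lemma special_class_cases:
  assumes "special_class m X C" "springer_rep m C \<chi>"
  obtains "\<chi> = triv_char m" | "\<chi> = refl_char m" | "\<chi> = sign_char m"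
proof -
  have "\<chi> \<in> special_chars m"
    using assms springer_rep_unique unfolding special_class_def by blast
  then show thesis using that by (auto simp: special_chars_def)
qed

lemma sign_closure:
  assumes "(D, {sign_char m}) \<in> closure_rel X P"
  shows "D = {sign_char m}"
proof -
  have step: "D = {sign_char m}" if "D \<in> X" "\<psi> \<in> D" "P (sign_char m) \<psi> \<noteq> 0" for D \<psi>
  proof -
    have "\<psi> = sign_char m" using P_sign[of \<psi>] that class_subset by blast
    then show ?thesis using sign_class that by blast
  qed
  from assms show ?thesis unfolding closure_rel_def
    by (induction rule: converse_trancl_induct) (use step in auto)
qed

text \<open>For the trivial character this is part (b), since a = 0. For the sign the piece is a
  single character. For \<open>refl_char\<close> the row is q times the trivial row wherever the
  class lies below.\<close>

lemma special_piece_row: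
  assumes C: "special_class m X C" and \<chi>: "springer_rep m C \<chi>"
    and \<phi>: "\<phi> \<in> irr m" and piece: "supp X \<phi> \<subseteq> special_piece m X P C"
  shows "P \<chi> \<phi> = (if springer_rep m (supp X \<phi>) \<phi> then q_var ^ a C else 0)"
proof -
  define D where "D = supp X \<phi>"
  have D: "D \<in> X" "\<phi> \<in> D" using supp_mem[OF \<phi>] by (auto simp: D_def)
  have CX: "C \<in> X" using C by (simp add: special_class_def)
  have \<chi>C: "\<chi> \<in> C" using \<chi> by (simp add: springer_rep_def)
  note aC = a_springer_rep[OF CX \<chi>]
  have "\<phi> \<in> special_piece m X P C" using piece D by (auto simp: D_def)
  then have DC: "D = C \<or> \<not> special_class m X D \<and> (D, C) \<in> closure_rel X P"
    unfolding special_piece_def using class_eq[OF D(1) _ D(2)] CX by blast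
  from C \<chi> show ?thesis
  proof (cases rule: special_class_cases)
    case 1
    then show ?thesis using triv_row[OF \<phi>] aC b_inv_triv[OF m3] by simp
  next
    case 3
    then have "C = {sign_char m}" using sign_class[OF CX] \<chi>C by simp
    then have "D = C" using DC sign_closure by blast
    then have "\<phi> = \<chi>" using D \<open>C = _\<close> 3 by simp
    then show ?thesis using P_block[OF CX \<chi>C \<chi>C] \<chi> \<open>D = C\<close> by (simp add: D_def)
  next
    case 2
    have r: "refl_char m = dihedral_char m 1 0" by (rule refl_char_eq)
    have b1: "b_inv m (refl_char m) = 1"
      unfolding r using m3 by (intro b_inv_dihedral_char) (auto simp: valid_param_def)
    \<comment> \<open>A special character represents the class containing it, so its presence would
      make D special, while a piece adds only nonspecial classes to C.\<close>
    have not_special: "\<psi> \<notin> D" if "D \<noteq> C" "\<psi> \<in> special_chars m" for \<psi>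
    proof
      assume "\<psi> \<in> D"
      then have "special_class m X D"
        using springer_rep_supp[OF that(2)] supp_eq[OF D(1)] D(1) that(2) by (auto simp: special_class_def)
      with DC that(1) show False by blast
    qed
    have "\<phi> \<noteq> sign_char m"
    proof
      assume "\<phi> = sign_char m"
      moreover from this have "D = C" using not_special[of "sign_char m"] D(2) by (auto simp: special_chars_def)
      ultimately have "C = {sign_char m}" using sign_class[OF CX] D(2) by simp
      then have "refl_char m = sign_char m" using \<chi>C 2 by simp
      then show False using b1 b_inv_sign[OF m3] m3 by simp
    qed
    moreover have "\<phi> \<in> \<Union>(below C)"
    proof (cases "D = C")
      case True
      then show ?thesis using D CX by (auto simp: below_def)
    next
      case False
      have "refl_char m \<noteq> triv_char m" "refl_char m \<noteq> sign_char m"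
        using b1 b_inv_triv[OF m3] b_inv_sign[OF m3] m3 by auto
      then have F: "refl_char m \<in> (irr m - {triv_char m, sign_char m}) \<inter> special_chars m"
        using refl_irr by (simp add: special_chars_def)
      have ns: "\<phi> \<notin> special_chars m" using not_special[OF False] D(2) by blast
      then have \<phi>F: "\<phi> \<in> (irr m - {triv_char m, sign_char m}) - special_chars m"
        using \<phi> unfolding special_chars_def by blast
      have "irr m - {triv_char m, sign_char m} \<in> families m"
        unfolding families_def by (rule insertI2, rule insertI2, rule insertI1)
      \<comment> \<open>Both characters lie in the large family, so the third Springer condition
        puts D at or below C in the total order, as \<open>two_dim_row\<close> requires.\<close>
      note springer_families[rule_format, OF this F \<phi>F]
      moreover have "supp X (refl_char m) = C" using supp_eq[OF CX \<chi>C] 2 by simp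
      ultimately show ?thesis using D by (auto simp: below_def D_def)
    qed
    ultimately have "P (refl_char m) \<phi> = q_var ^ 1 * P (triv_char m) \<phi>"
      unfolding r using two_dim_row[OF CX, of 1 \<phi>] \<chi> 2 m3 r by simp
    then show ?thesis using triv_row[OF \<phi>] 2 aC b1 by simp
  qed
qed

end

theorem theorem3p3:
  fixes m :: nat
    and X :: "class_fun set set"
    and lt :: "class_fun set rel"
    and a :: "class_fun set \<Rightarrow> nat"
    and P \<Lambda> :: char_matrix
  assumes "m \<ge> 3"
    and "springer_correspondence m X lt a P \<Lambda>"
  shows "(\<forall>C \<chi>. special_class m X C \<longrightarrow> springer_rep m C \<chi> \<longrightarrow>
            (\<forall>\<chi>'\<in>irr m. supp X \<chi>' \<subseteq> special_piece m X P C \<longrightarrow>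
               P \<chi> \<chi>' = (if springer_rep m (supp X \<chi>') \<chi>' then q_var ^ a C else 0)))
       \<and> (\<forall>\<chi>'\<in>irr m.
            P (triv_char m) \<chi>' = (if springer_rep m (supp X \<chi>') \<chi>' then 1 else 0))"
proof -
  interpret springer m X lt a P \<Lambda>
    by (rule springer.intro) (fact assms)+
  show ?thesis using special_piece_row triv_row by blast
qed

end
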